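(* Let $n\ge2$, $1\le k\le n-1$, $\alpha_1,\alpha_2\in\mathbb{R}$ with $\alpha_1\ge k-n$, and $p=\frac{\alpha_1+n}{k}\ge1+\alpha_2$, with strict inequality $p>1+\alpha_2$ when $\alpha_2>0$. For $\gamma\in\mathbb{R}$ consider $$\|\cos^\gamma d(0,\cdot)\,R_kf\|_{L^\infty(\Xi_k(\mathbb{S}^n))}\le C\|f\|_{L^{p,1}_{\alpha_1,\alpha_2}(\mathbb{S}^n)}\quad\text{for all even radial }f\in L^{p,1}_{\alpha_1,\alpha_2}(\mathbb{S}^n).\qquad( * )$$ (A) If $k\ge2$, $( * )$ holds if and only if $\gamma\ge\frac{1+\alpha_2}{p}$. (B) If $k=1$, $( * )$ holds if and only if $\gamma\ge\frac{1+\alpha_2}{p}$ and $p\ge2$.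
   Context: $\mathbb{S}^n\subset\mathbb{R}^{n+1}$ unit sphere with origin $0:=e_{n+1}$, distance $d$, surface measure $dx$. $\Xi_k(\mathbb{S}^n)$: $k$-dimensional totally geodesic submanifolds (intersections with $(k+1)$-dimensional linear subspaces) with $d(0,\xi)<\pi/2$, with rotation-invariant measure ($L^\infty$ = essential supremum). $R_kf(\xi)=\int_\xi f\,d_\xi x$. $L^{p,1}_{\alpha_1,\alpha_2}(\mathbb{S}^n)$ is the Lorentz space $L^{p,1}(\mathbb{S}^n,\mu)$ for $d\mu=\sin^{\alpha_1}d(0,x)|\cos d(0,x)|^{\alpha_2}dx$, with norm $p\int_0^\infty\mu(\{|f|>s\})^{1/p}ds$. Even radial: $f(x)=F(|x_{n+1}|)$. $C$ independent of $f$. *)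

theory Defs
  imports "HOL-Analysis.Analysis"
begin

text \<open>Surface measure on the unit sphere of a Euclidean space of dimension N:
  the push-forward of Lebesgue measure on the punctured unit ball under radial
  projection, multiplied by N (volume of the cone over A equals surface(A)/N).\<close>
definition sphere_measure :: "'a::euclidean_space measure" where
  "sphere_measure =
     density (distr (restrict_space lborel (ball 0 1 - {0}))
                    (restrict_space borel (sphere 0 1)) (\<lambda>y. y /\<^sub>R norm y))
             (\<lambda>_. of_nat DIM('a))"

definition sdist :: "'a::real_inner \<Rightarrow> 'a \<Rightarrow> real" where
  "sdist x y = arccos (x \<bullet> y)"

definition sdist_set :: "'a::real_inner \<Rightarrow> 'a set \<Rightarrow> real" where
  "sdist_set x S = Inf (sdist x ` S)"

definition enn_powr :: "ennreal \<Rightarrow> real \<Rightarrow> ennreal" where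
  "enn_powr x r = (if x = \<infinity> then \<infinity> else ennreal (enn2real x powr r))"

definition weighted_sphere_measure :: "'a::euclidean_space \<Rightarrow> real \<Rightarrow> real \<Rightarrow> 'a measure" where
  "weighted_sphere_measure ctr a1 a2 =
     density sphere_measure
       (\<lambda>x. ennreal (sin (sdist ctr x) powr a1 * \<bar>cos (sdist ctr x)\<bar> powr a2))"

definition lorentz_norm :: "'a measure \<Rightarrow> real \<Rightarrow> ('a \<Rightarrow> real) \<Rightarrow> ennreal" where
  "lorentz_norm M p f =
     ennreal p * (\<integral>\<^sup>+ s\<in>{0..}. enn_powr (emeasure M {x\<in>space M. \<bar>f x\<bar> > s}) (1/p) \<partial>lborel)"

definition even_radial :: "'a::real_inner \<Rightarrow> ('a \<Rightarrow> real) \<Rightarrow> bool" where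
  "even_radial ctr f \<longleftrightarrow> (\<exists>F. \<forall>x\<in>sphere 0 1. f x = F \<bar>x \<bullet> ctr\<bar>)"

definition param_iso :: "(real^'j::finite) set \<Rightarrow> (real^'k::finite \<Rightarrow> real^'j)" where
  "param_iso V = (SOME T. linear T \<and> (\<forall>y. norm (T y) = norm y) \<and> range T = V)"

text \<open>k-plane transform: integral of f over the great k-sphere xi = V \<inter> S^n,
  V a (k+1)-dimensional subspace, with the k-dimensional surface measure of xi.\<close>
definition radon_integrable :: "'k::finite itself \<Rightarrow> (real^'j \<Rightarrow> real) \<Rightarrow> (real^'j) set \<Rightarrow> bool" where
  "radon_integrable _ f V =
     integrable (sphere_measure :: (real^'k) measure) (\<lambda>y. f (param_iso V y))"

definition radon :: "'k::finite itself \<Rightarrow> (real^'j \<Rightarrow> real) \<Rightarrow> (real^'j) set \<Rightarrow> real" where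
  "radon _ f V = (\<integral>y. f (param_iso V y) \<partial>(sphere_measure :: (real^'k) measure))"

text \<open>Almost-everywhere with respect to the rotation invariant measure on Xi_k:
  a set of planes is null iff the set of matrices A (Lebesgue measure on
  (n+1) x (k+1) matrices) whose column space lies in it is null. We restrict to
  A of full rank k+1 whose column space xi satisfies d(ctr, xi) < pi/2.\<close>
definition AE_planes :: "'k::finite itself \<Rightarrow> real^'j \<Rightarrow> ((real^'j) set \<Rightarrow> bool) \<Rightarrow> bool" where
  "AE_planes _ ctr P \<longleftrightarrow>
     (AE A in (lborel :: (real^'k^'j) measure).
        (inj (\<lambda>y. A *v y) \<and> sdist_set ctr (range (\<lambda>y. A *v y) \<inter> sphere 0 1) < pi / 2)
        \<longrightarrow> P (range (\<lambda>y. A *v y)))"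

text \<open>The estimate (*):
  || cos^gamma d(ctr,.) R_k f ||_{L^infty(Xi_k)} <= C ||f||_{L^{p,1}_{a1,a2}}
  for all even radial f in L^{p,1}_{a1,a2}; the L^infty bound is written out as an
  almost-everywhere bound (which is what ess sup <= c means), together with
  a.e. definedness of R_k f.\<close>
definition radon_estimate :: "'k::finite itself \<Rightarrow> real^'j \<Rightarrow> real \<Rightarrow> real \<Rightarrow> real \<Rightarrow> real \<Rightarrow> bool" where
  "radon_estimate K ctr a1 a2 p \<gamma> \<longleftrightarrow>
     (\<exists>C::real. C \<ge> 0 \<and>
        (\<forall>f. f \<in> borel_measurable (sphere_measure :: (real^'j) measure) \<longrightarrow>
             even_radial ctr f \<longrightarrow>
             lorentz_norm (weighted_sphere_measure ctr a1 a2) p f < \<infinity> \<longrightarrow>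
             AE_planes K ctr (\<lambda>V. radon_integrable K f V \<and>
                ennreal \<bar>cos (sdist_set ctr (V \<inter> sphere 0 1)) powr \<gamma> * radon K f V\<bar>
                  \<le> ennreal C * lorentz_norm (weighted_sphere_measure ctr a1 a2) p f)))"

end

theory Submission
  imports Defs
begin

text \<open>In the coordinate t = |x . e|, with c the cosine of the distance from e to the plane, the transform
  of f(x) = F(|x . e|) over a great k-sphere is a constant times the integral of F(c t) (1 - t^2)^(k/2 - 1)
  over 0 < t < 1, and the weighted measure on the sphere becomes a constant times
  t^a2 (1 - t^2)^(p k/2 - 1) dt.  The layer-cake formula reduces the estimate to indicator functions.
  If p k \<ge> 2, dilation by c costs exactly the factor c^(- (1 + a2)/p) and leaves a restricted-type
  inequality at c = 1.  Conversely, testing on the band \<delta> (1 - \<eta>) < |x . e| < \<delta> and planes with c near \<delta>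
  gives \<delta>^\<gamma> \<eta>^(k/2) \<le> D \<delta>^((1 + a2)/p) \<eta>^(1/p) for small \<delta> and \<eta>: letting \<delta> tend to 0 bounds \<gamma> from
  below, and letting \<eta> tend to 0 gives p k \<ge> 2, a restriction only when k = 1.\<close>

section \<open>Slice integration on the sphere\<close>

text \<open>Evaluate the double integral of 1(x in A) 1(y - x in B) over lborel and M in both orders.\<close>
lemma translation_invariant_proportional_lborel:
  fixes M :: "'a::euclidean_space measure"
  assumes sigma_finite: "sigma_finite_measure M" and sets_M [measurable_cong]: "sets M = sets borel"
    and M_shift: "\<And>x. distr M borel ((+) x) = M"
    and [measurable]: "A \<in> sets borel" "B \<in> sets borel" and symmetric: "\<And>x. - x \<in> B \<longleftrightarrow> x \<in> B"
  shows "emeasure lborel A * emeasure M B = emeasure lborel B * emeasure M A"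
proof -
  interpret M: sigma_finite_measure M by (rule sigma_finite)
  interpret P: pair_sigma_finite "lborel :: 'a measure" M ..
  have shift: "(\<integral>\<^sup>+y. g (x + y) \<partial>N) = (\<integral>\<^sup>+y. g y \<partial>N)"
    if [measurable_cong]: "sets N = sets borel" and N_shift: "\<And>x. distr N borel ((+) x) = N"
      and [measurable]: "g \<in> borel_measurable borel" for N and g :: "'a \<Rightarrow> ennreal" and x
    by (subst (2) N_shift[of x, symmetric]) (simp add: nn_integral_distr)
  have "emeasure lborel A * emeasure M B
      = (\<integral>\<^sup>+x. indicator A x * (\<integral>\<^sup>+y. indicator B (- x + y) \<partial>M) \<partial>lborel)"
    by (subst shift[of M]) (simp_all add: M_shift sets_M nn_integral_multc)
  also have "\<dots> = (\<integral>\<^sup>+x. (\<integral>\<^sup>+y. indicator A x * indicator B (- x + y) \<partial>M) \<partial>lborel)"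
    by (simp add: nn_integral_cmult)
  also have "\<dots> = (\<integral>\<^sup>+y. (\<integral>\<^sup>+x. indicator A x * indicator B (- x + y) \<partial>lborel) \<partial>M)"
    by (rule P.Fubini'[symmetric]) measurable
  also have "\<dots> = (\<integral>\<^sup>+y. (\<integral>\<^sup>+x. indicator A (y + x) * indicator B x \<partial>lborel) \<partial>M)"
  proof (rule nn_integral_cong)
    fix y
    have "(\<integral>\<^sup>+x. indicator A x * indicator B (- x + y) \<partial>lborel)
        = (\<integral>\<^sup>+x. indicator A (y + x) * indicator B (- (y + x) + y) \<partial>lborel)"
      by (rule shift[symmetric]) (simp_all add: lborel_distr_plus)
    then show "(\<integral>\<^sup>+x. indicator A x * indicator B (- x + y) \<partial>lborel)
        = (\<integral>\<^sup>+x. indicator A (y + x) * indicator B x \<partial>lborel)"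
      using symmetric by (simp add: indicator_def)
  qed
  also have "\<dots> = (\<integral>\<^sup>+x. (\<integral>\<^sup>+y. indicator A (y + x) * indicator B x \<partial>M) \<partial>lborel)"
    by (rule P.Fubini') measurable
  also have "\<dots> = (\<integral>\<^sup>+x. (\<integral>\<^sup>+y. indicator A (x + y) \<partial>M) * indicator B x \<partial>lborel)"
    by (simp add: nn_integral_multc add.commute)
  also have "\<dots> = emeasure lborel B * emeasure M A"
    by (subst shift[of M]) (simp_all add: M_shift sets_M nn_integral_multc mult.commute)
  finally show ?thesis .
qed

lemma borel_measurable_linear:
  fixes T :: "'a::euclidean_space \<Rightarrow> 'b::real_normed_vector"
  shows "linear T \<Longrightarrow> T \<in> borel_measurable borel"
  by (intro borel_measurable_continuous_onI linear_continuous_on) (simp add: linear_conv_bounded_linear)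

lemma distr_lborel_orthogonal_transformation:
  fixes T :: "'a::euclidean_space \<Rightarrow> 'a"
  assumes "orthogonal_transformation T"
  shows "distr lborel borel T = lborel"
proof -
  have linear_T: "linear T" and norm_T: "norm (T x) = norm x" for x
    using assms by (auto simp: orthogonal_transformation)
  have [measurable]: "T \<in> borel_measurable borel"
    using linear_T by (rule borel_measurable_linear)
  define M where "M = distr lborel borel T"
  have [measurable_cong]: "sets M = sets borel" and space_eq: "space M = UNIV" by (simp_all add: M_def)
  have M_ball: "emeasure M (ball 0 r) = emeasure lborel (ball (0::'a) r)" for r
    by (simp add: M_def emeasure_distr vimage_def norm_T ball_def dist_norm)
  have "sigma_finite_measure M"
  proof
    show "\<exists>A. countable A \<and> A \<subseteq> sets M \<and> \<Union> A = space M \<and> (\<forall>a\<in>A. emeasure M a \<noteq> \<infinity>)"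
      by (intro exI[of _ "range (\<lambda>n::nat. ball (0::'a) n)"])
         (auto simp: M_ball emeasure_ball reals_Archimedean2 space_eq)
  qed
  moreover have "distr M borel ((+) x) = M" for x
  proof -
    obtain y where x_eq: "x = T y"
      using orthogonal_transformation_surj[OF assms] by blast
    have "distr M borel ((+) x) = distr (distr lborel borel ((+) y)) borel T"
      unfolding M_def by (simp add: distr_distr comp_def x_eq linear_add[OF linear_T])
    then show ?thesis by (simp add: lborel_distr_plus M_def)
  qed
  ultimately have proportional: "emeasure lborel A * emeasure M (ball 0 1)
      = emeasure lborel (ball (0::'a) 1) * emeasure M A"
    if "A \<in> sets borel" for A
    using that by (intro translation_invariant_proportional_lborel) (auto simp: M_def)
  have "emeasure lborel (ball (0::'a) 1) \<noteq> 0" "emeasure lborel (ball (0::'a) 1) \<noteq> top"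
    using unit_ball_vol_pos[of "real DIM('a)"] by (auto simp: emeasure_ball simp del: unit_ball_vol_pos)
  then have "emeasure M A = emeasure lborel A" if "A \<in> sets borel" for A
    using proportional[OF that] by (metis M_ball ennreal_mult_cancel_left mult.commute)
  then have "M = lborel" by (intro measure_eqI) (auto simp: M_def)
  then show ?thesis by (simp add: M_def)
qed

lemma space_sphere_measure [simp]: "space sphere_measure = sphere 0 1"
  by (simp add: sphere_measure_def space_restrict_space)

lemma sets_sphere_measure [simp, measurable_cong]:
  "sets sphere_measure = sets (restrict_space borel (sphere 0 1))"
  by (simp add: sphere_measure_def)

lemma borel_measurable_sphere_measure [measurable (raw)]:
  "f \<in> borel_measurable borel \<Longrightarrow> f \<in> borel_measurable sphere_measure"
  by (subst measurable_cong_sets[OF sets_sphere_measure refl]) (rule measurable_restrict_space1)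

lemma nn_integral_sphere_measure:
  fixes g :: "'a::euclidean_space \<Rightarrow> ennreal"
  assumes g_meas [measurable]: "g \<in> borel_measurable borel"
  shows "(\<integral>\<^sup>+y. g y \<partial>sphere_measure) =
    of_nat DIM('a) * (\<integral>\<^sup>+y. g (y /\<^sub>R norm y) * indicator (ball 0 1 - {0}) y \<partial>lborel)"
proof -
  have "(\<lambda>y::'a. y /\<^sub>R norm y) \<in> borel_measurable (restrict_space lborel (ball 0 1 - {0}))"
    by (intro measurable_restrict_space1) measurable
  then have "(\<lambda>y::'a. y /\<^sub>R norm y)
      \<in> measurable (restrict_space lborel (ball 0 1 - {0})) (restrict_space borel (sphere 0 1))"
    by (intro measurable_restrict_space2) (auto simp: space_restrict_space)
  then show ?thesis
    unfolding sphere_measure_def using measurable_restrict_space1[OF g_meas, of "sphere 0 1"]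
    by (simp add: nn_integral_density nn_integral_cmult nn_integral_distr nn_integral_restrict_space)
qed

lemma nn_integral_monomial:
  fixes b C :: real
  assumes "0 \<le> b" "0 \<le> C"
  shows "(\<integral>\<^sup>+x. ennreal (C * x ^ m) * indicator {0..<b} x \<partial>lborel) = ennreal (C * b ^ (m + 1) / (m + 1))"
proof -
  have "(\<integral>\<^sup>+x. ennreal (C * x ^ m) * indicator {0..<b} x \<partial>lborel)
      = (\<integral>\<^sup>+x. ennreal (C * x ^ m) * indicator {0..b} x \<partial>lborel)"
    by (intro nn_integral_cong_AE eventually_mono[OF AE_lborel_singleton[of b]]) (auto split: split_indicator)
  also have "\<dots> = ennreal (C * b ^ (m + 1) / (m + 1) - C * 0 ^ (m + 1) / (m + 1))"
    using assms by (intro nn_integral_FTC_Icc) (auto intro!: derivative_eq_intros simp del: power_Suc)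
  finally show ?thesis by simp
qed

lemma emeasure_PiM_lborel_L2_set_atMost:
  assumes finite: "finite A" and nonempty: "A \<noteq> {}"
  defines "M \<equiv> Pi\<^sub>M A (\<lambda>_. lborel :: real measure)"
  shows "emeasure M {x \<in> space M. L2_set x A \<le> r} = ennreal (unit_ball_vol (card A) * max 0 r ^ card A)"
proof -
  have ball: "emeasure M {x \<in> space M. L2_set x A \<le> s} = ennreal (unit_ball_vol (card A) * s ^ card A)"
    if "s > 0" for s
    using emeasure_cball_aux[OF finite that] by (simp add: M_def L2_set_def Collect_conj_eq Int_commute)
  have [measurable]: "{x \<in> space M. L2_set x A \<le> s} \<in> sets M" for s
    unfolding M_def L2_set_def by measurable
  show ?thesis
  proof (cases "r > 0")
    case True
    then show ?thesis by (simp add: ball)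
  next
    case False
    have "emeasure M {x \<in> space M. L2_set x A \<le> r} \<le> ennreal (unit_ball_vol (card A) * s ^ card A)"
      if "s > 0" for s
      unfolding ball[OF that, symmetric] using that False by (intro emeasure_mono) auto
    then have "eventually (\<lambda>s. emeasure M {x \<in> space M. L2_set x A \<le> r} \<le>
        ennreal (unit_ball_vol (card A) * s ^ card A)) (at_right 0)"
      by (simp add: eventually_at_filter)
    moreover have "((\<lambda>s. ennreal (unit_ball_vol (card A) * s ^ card A)) \<longlongrightarrow>
        ennreal (unit_ball_vol (card A) * 0 ^ card A)) (at_right 0)"
      by (intro tendsto_ennrealI tendsto_intros)
    ultimately have "emeasure M {x \<in> space M. L2_set x A \<le> r} \<le> ennreal (unit_ball_vol (card A) * 0 ^ card A)"
      by (intro tendsto_lowerbound) auto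
    moreover have "card A > 0" using finite nonempty by (simp add: card_gt_0_iff)
    ultimately show ?thesis using False by (simp add: max_absorb1 zero_power)
  qed
qed

lemma distr_PiM_lborel_L2_set:
  assumes finite: "finite A" and nonempty: "A \<noteq> {}"
  shows "distr (Pi\<^sub>M A (\<lambda>_. lborel :: real measure)) borel (\<lambda>x. L2_set x A) =
    density lborel (\<lambda>r. ennreal (unit_ball_vol (card A) * card A * r ^ (card A - 1)) * indicator {0..} r)"
    (is "?distr = ?density")
proof -
  let ?M = "Pi\<^sub>M A (\<lambda>_. lborel :: real measure)"
  let ?V = "unit_ball_vol (card A)"
  have card: "card A > 0" using finite nonempty by (simp add: card_gt_0_iff)
  have [measurable]: "(\<lambda>x. L2_set x A) \<in> borel_measurable ?M" unfolding L2_set_def by measurable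
  have distr_atMost: "emeasure ?distr {..r} = ennreal (?V * max 0 r ^ card A)" for r
    using emeasure_PiM_lborel_L2_set_atMost[OF finite nonempty, of r]
    by (simp add: emeasure_distr vimage_def Int_def conj_commute)
  have density_atMost: "emeasure ?density {..r} = ennreal (?V * max 0 r ^ card A)" for r
  proof -
    have "emeasure ?density {..r}
        = (\<integral>\<^sup>+s. ennreal (?V * card A * s ^ (card A - 1)) * indicator {0..<max 0 r} s \<partial>lborel)"
      by (subst emeasure_density, simp, simp,
          intro nn_integral_cong_AE eventually_mono[OF AE_lborel_singleton[of r]])
         (auto simp: max_def split: split_indicator if_splits)
    also have "\<dots> = ennreal (?V * max 0 r ^ card A)"
      using card by (subst nn_integral_monomial) (auto simp: unit_ball_vol_nonneg of_nat_diff)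
    finally show ?thesis .
  qed
  show ?thesis
  proof (rule measure_eqI_generator_eq)
    show "Int_stable (range atMost :: real set set)"
      by (auto simp: Int_stable_def)
    show "sets ?distr = sigma_sets UNIV (range atMost)" "sets ?density = sigma_sets UNIV (range atMost)"
      by (simp_all add: borel_eq_atMost)
    show "range (\<lambda>n. {..real n}) \<subseteq> range atMost" "(\<Union>n. {..real n}) = UNIV"
      using real_arch_simple by auto
  qed (auto simp: distr_atMost density_atMost simp del: One_nat_def)
qed

lemma nn_integral_cylindrical:
  fixes e :: "'a::euclidean_space" and H :: "real \<Rightarrow> real \<Rightarrow> ennreal"
  assumes e_Basis: "e \<in> Basis" and dim_ge_2: "DIM('a) \<ge> 2"
    and H_meas [measurable]: "case_prod H \<in> borel_measurable (borel \<Otimes>\<^sub>M borel)"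
  defines "m \<equiv> DIM('a) - 1"
  shows "(\<integral>\<^sup>+x. H (norm x) (x \<bullet> e) \<partial>(lborel :: 'a measure)) =
    (\<integral>\<^sup>+\<rho>. ennreal (unit_ball_vol m * m * \<rho> ^ (m - 1)) * indicator {0..} \<rho> *
       (\<integral>\<^sup>+y. H (sqrt (\<rho>\<^sup>2 + y\<^sup>2)) y \<partial>lborel) \<partial>lborel)"
proof -
  define A where "A = Basis - {e}"
  have finite_A: "finite A" and e_notin: "e \<notin> A" and insert_A: "insert e A = Basis" and card_A: "card A = m"
    using e_Basis by (auto simp: A_def m_def card_Diff_singleton)
  have A_nonempty: "A \<noteq> {}" using card_A dim_ge_2 by (auto simp: m_def)
  let ?M = "Pi\<^sub>M A (\<lambda>_. lborel) :: ('a \<Rightarrow> real) measure"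
  interpret product_sigma_finite "\<lambda>_::'a. lborel :: real measure" by standard
  have [measurable]: "(\<lambda>x. L2_set x A) \<in> borel_measurable ?M"
    "(\<lambda>x. L2_set x A) \<in> borel_measurable (Pi\<^sub>M (insert e A) (\<lambda>_. lborel :: real measure))"
    unfolding L2_set_def by measurable
  have "norm (\<Sum>b\<in>Basis. x b *\<^sub>R b :: 'a) = sqrt ((L2_set x A)\<^sup>2 + (x e)\<^sup>2)" for x
  proof -
    have "norm (\<Sum>b\<in>Basis. x b *\<^sub>R b :: 'a) = sqrt (\<Sum>b\<in>insert e A. (x b)\<^sup>2)"
      unfolding insert_A by (subst norm_eq_sqrt_inner, subst euclidean_inner) (simp add: power2_eq_square)
    then show ?thesis using finite_A e_notin by (simp add: L2_set_def sum_nonneg add.commute)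
  qed
  then have "(\<integral>\<^sup>+x. H (norm x) (x \<bullet> e) \<partial>(lborel :: 'a measure))
      = (\<integral>\<^sup>+x. H (sqrt ((L2_set x A)\<^sup>2 + (x e)\<^sup>2)) (x e) \<partial>Pi\<^sub>M (insert e A) (\<lambda>_. lborel))"
    unfolding insert_A using e_Basis
    by (subst lborel_eq) (simp add: nn_integral_distr inner_sum_left inner_Basis if_distrib cong: if_cong)
  also have "\<dots> = (\<integral>\<^sup>+x. (\<integral>\<^sup>+y. H (sqrt ((L2_set x A)\<^sup>2 + y\<^sup>2)) y \<partial>lborel) \<partial>?M)"
  proof (subst product_nn_integral_insert)
    have "L2_set (x(e := y)) A = L2_set x A" for x :: "'a \<Rightarrow> real" and y
      using e_notin by (intro L2_set_cong) auto
    then show "(\<integral>\<^sup>+x. (\<integral>\<^sup>+y. H (sqrt ((L2_set (x(e := y)) A)\<^sup>2 + ((x(e := y)) e)\<^sup>2)) ((x(e := y)) e) \<partial>lborel) \<partial>?M)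
      = (\<integral>\<^sup>+x. (\<integral>\<^sup>+y. H (sqrt ((L2_set x A)\<^sup>2 + y\<^sup>2)) y \<partial>lborel) \<partial>?M)" by simp
  qed (use finite_A e_notin in simp_all)
  also have "\<dots> = (\<integral>\<^sup>+\<rho>. (\<integral>\<^sup>+y. H (sqrt (\<rho>\<^sup>2 + y\<^sup>2)) y \<partial>lborel) \<partial>distr ?M borel (\<lambda>x. L2_set x A))"
    by (rule nn_integral_distr[symmetric]) measurable
  also have "\<dots> = (\<integral>\<^sup>+\<rho>. ennreal (unit_ball_vol m * m * \<rho> ^ (m - 1)) * indicator {0..} \<rho> *
       (\<integral>\<^sup>+y. H (sqrt (\<rho>\<^sup>2 + y\<^sup>2)) y \<partial>lborel) \<partial>lborel)"
    unfolding distr_PiM_lborel_L2_set[OF finite_A A_nonempty] card_A by (rule nn_integral_density) measurable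
  finally show ?thesis .
qed

text \<open>The substitution y = \<rho> \<tau> makes the direction depend on \<tau> alone.\<close>
lemma nn_integral_direction_line:
  fixes G :: "real \<Rightarrow> ennreal"
  assumes [measurable]: "G \<in> borel_measurable borel" and \<rho>_pos: "\<rho> > 0"
  shows "(\<integral>\<^sup>+y. G (\<bar>y\<bar> / sqrt (\<rho>\<^sup>2 + y\<^sup>2)) * indicator {0<..<1} (sqrt (\<rho>\<^sup>2 + y\<^sup>2)) \<partial>lborel) =
    ennreal \<rho> * (\<integral>\<^sup>+\<tau>. G (\<bar>\<tau>\<bar> / sqrt (1 + \<tau>\<^sup>2)) * indicator {0..<1 / sqrt (1 + \<tau>\<^sup>2)} \<rho> \<partial>lborel)"
proof -
  let ?H = "\<lambda>y. G (\<bar>y\<bar> / sqrt (\<rho>\<^sup>2 + y\<^sup>2)) * indicator {0<..<1} (sqrt (\<rho>\<^sup>2 + y\<^sup>2))"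
  have "?H (0 + \<rho> * \<tau>) = G (\<bar>\<tau>\<bar> / sqrt (1 + \<tau>\<^sup>2)) * indicator {0..<1 / sqrt (1 + \<tau>\<^sup>2)} \<rho>" for \<tau>
  proof -
    have radius: "sqrt (\<rho>\<^sup>2 + (0 + \<rho> * \<tau>)\<^sup>2) = \<rho> * sqrt (1 + \<tau>\<^sup>2)"
      using \<rho>_pos by (intro real_sqrt_unique) (auto simp: power_mult_distrib algebra_simps)
    have "sqrt (1 + \<tau>\<^sup>2) > 0" by (simp add: add_pos_nonneg)
    then show ?thesis
      unfolding radius using \<rho>_pos by (auto simp: abs_mult field_simps split: split_indicator)
  qed
  moreover have "(\<integral>\<^sup>+y. ?H y \<partial>lborel) = ennreal \<bar>\<rho>\<bar> * (\<integral>\<^sup>+\<tau>. ?H (0 + \<rho> * \<tau>) \<partial>lborel)"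
    using \<rho>_pos by (intro nn_integral_real_affine) auto
  ultimately show ?thesis using \<rho>_pos by simp
qed

lemma nn_integral_direction_line_weighted:
  fixes G :: "real \<Rightarrow> ennreal"
  assumes [measurable]: "G \<in> borel_measurable borel" and C_nonneg: "C \<ge> 0" and m_pos: "m > 0"
    and \<rho>_nonzero: "\<rho> \<noteq> 0"
  shows "ennreal (C * \<rho> ^ (m - 1)) * indicator {0..} \<rho> *
      (\<integral>\<^sup>+y. G (\<bar>y\<bar> / sqrt (\<rho>\<^sup>2 + y\<^sup>2)) * indicator {0<..<1} (sqrt (\<rho>\<^sup>2 + y\<^sup>2)) \<partial>lborel) =
    (\<integral>\<^sup>+\<tau>. G (\<bar>\<tau>\<bar> / sqrt (1 + \<tau>\<^sup>2)) * (ennreal (C * \<rho> ^ m) * indicator {0..<1 / sqrt (1 + \<tau>\<^sup>2)} \<rho>) \<partial>lborel)"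
proof (cases "\<rho> > 0")
  case True
  have "ennreal (C * \<rho> ^ m) = ennreal (C * \<rho> ^ (m - 1)) * ennreal \<rho>"
    using True C_nonneg power_minus_mult[OF m_pos, of \<rho>] by (simp add: ennreal_mult[symmetric] mult.assoc)
  moreover have "(\<lambda>\<tau>. G (\<bar>\<tau>\<bar> / sqrt (1 + \<tau>\<^sup>2)) * indicator {0..<1 / sqrt (1 + \<tau>\<^sup>2)} \<rho>) \<in> borel_measurable lborel"
    unfolding indicator_def atLeastLessThan_iff by measurable
  ultimately show ?thesis
    using True by (simp add: nn_integral_direction_line mult.assoc mult.left_commute[of "G _"] nn_integral_cmult)
qed (use \<rho>_nonzero in \<open>simp add: indicator_def\<close>)

lemma inverse_sqrt_power: "0 < x \<Longrightarrow> (1 / sqrt x) ^ n = x powr - (real n / 2)"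
  by (simp add: powr_half_sqrt[symmetric] powr_minus_divide[symmetric] powr_realpow[symmetric] powr_powr)

lemma nn_integral_ball_direction:
  fixes e :: "'a::euclidean_space" and G :: "real \<Rightarrow> ennreal"
  assumes e_Basis: "e \<in> Basis" and dim_ge_2: "DIM('a) \<ge> 2"
    and G_meas [measurable]: "G \<in> borel_measurable borel"
  defines "m \<equiv> DIM('a) - 1"
  shows "(\<integral>\<^sup>+y. G \<bar>(y /\<^sub>R norm y) \<bullet> e\<bar> * indicator (ball 0 1 - {0}) (y::'a) \<partial>lborel) =
    ennreal (unit_ball_vol m * m / DIM('a)) *
      (\<integral>\<^sup>+\<tau>. G (\<bar>\<tau>\<bar> / sqrt (1 + \<tau>\<^sup>2)) * ennreal ((1 + \<tau>\<^sup>2) powr - (real DIM('a) / 2)) \<partial>lborel)"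
proof -
  define C where "C = unit_ball_vol m * m"
  have C_nonneg: "C \<ge> 0" by (simp add: C_def unit_ball_vol_nonneg)
  have m_pos: "m > 0" and Suc_m: "m + 1 = DIM('a)" "real m + 1 = real DIM('a)"
    using dim_ge_2 by (auto simp: m_def)
  define b where "b \<tau> = 1 / sqrt (1 + \<tau>\<^sup>2)" for \<tau> :: real
  let ?g = "\<lambda>\<tau>. G (\<bar>\<tau>\<bar> / sqrt (1 + \<tau>\<^sup>2))"
  define H where "H r y = G (\<bar>y\<bar> / r) * indicator {0<..<1} r" for r y :: real
  have H_meas: "case_prod H \<in> borel_measurable (borel \<Otimes>\<^sub>M borel)"
    unfolding H_def by measurable
  have radial: "(\<integral>\<^sup>+\<rho>. ?g \<tau> * (ennreal (C * \<rho> ^ m) * indicator {0..<b \<tau>} \<rho>) \<partial>lborel)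
      = ennreal (C / DIM('a)) * (?g \<tau> * ennreal ((1 + \<tau>\<^sup>2) powr - (real DIM('a) / 2)))" for \<tau>
  proof -
    have "0 \<le> b \<tau>" "b \<tau> ^ DIM('a) = (1 + \<tau>\<^sup>2) powr - (real DIM('a) / 2)"
      unfolding b_def by (simp_all add: inverse_sqrt_power add_pos_nonneg)
    then have "(\<integral>\<^sup>+\<rho>. ennreal (C * \<rho> ^ m) * indicator {0..<b \<tau>} \<rho> \<partial>lborel)
        = ennreal (C / DIM('a)) * ennreal ((1 + \<tau>\<^sup>2) powr - (real DIM('a) / 2))"
      using nn_integral_monomial[of "b \<tau>" C m, unfolded Suc_m] C_nonneg by (simp add: ennreal_mult[symmetric])
    then show ?thesis by (subst nn_integral_cmult) (simp_all add: mult_ac)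
  qed
  have "(\<integral>\<^sup>+y. G \<bar>(y /\<^sub>R norm y) \<bullet> e\<bar> * indicator (ball 0 1 - {0}) (y::'a) \<partial>lborel)
      = (\<integral>\<^sup>+y. H (norm y) (y \<bullet> e) \<partial>(lborel :: 'a measure))"
    by (intro nn_integral_cong) (auto simp: H_def abs_mult divide_inverse mult.commute split: split_indicator)
  also have "\<dots>
      = (\<integral>\<^sup>+\<rho>. ennreal (C * \<rho> ^ (m - 1)) * indicator {0..} \<rho> * (\<integral>\<^sup>+y. H (sqrt (\<rho>\<^sup>2 + y\<^sup>2)) y \<partial>lborel) \<partial>lborel)"
    unfolding C_def m_def by (rule nn_integral_cylindrical[OF e_Basis dim_ge_2 H_meas])
  also have "\<dots> = (\<integral>\<^sup>+\<rho>. (\<integral>\<^sup>+\<tau>. ?g \<tau> * (ennreal (C * \<rho> ^ m) * indicator {0..<b \<tau>} \<rho>) \<partial>lborel) \<partial>lborel)"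
    unfolding H_def b_def
    by (intro nn_integral_cong_AE eventually_mono[OF AE_lborel_singleton[of 0]]
        nn_integral_direction_line_weighted G_meas C_nonneg m_pos)
  also have "\<dots> = (\<integral>\<^sup>+\<tau>. (\<integral>\<^sup>+\<rho>. ?g \<tau> * (ennreal (C * \<rho> ^ m) * indicator {0..<b \<tau>} \<rho>) \<partial>lborel) \<partial>lborel)"
    unfolding b_def indicator_def atLeastLessThan_iff by (rule lborel_pair.Fubini'[symmetric]) measurable
  also have "\<dots> = ennreal (C / DIM('a)) * (\<integral>\<^sup>+\<tau>. ?g \<tau> * ennreal ((1 + \<tau>\<^sup>2) powr - (real DIM('a) / 2)) \<partial>lborel)"
    unfolding radial by (rule nn_integral_cmult) measurable
  finally show ?thesis by (simp add: C_def)
qed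

lemma nn_integral_even:
  fixes h :: "real \<Rightarrow> ennreal"
  assumes [measurable]: "h \<in> borel_measurable borel"
  shows "(\<integral>\<^sup>+x. h \<bar>x\<bar> \<partial>lborel) = 2 * (\<integral>\<^sup>+x. h x * indicator {0..} x \<partial>lborel)"
proof -
  have "(\<integral>\<^sup>+x. h \<bar>x\<bar> \<partial>lborel) = (\<integral>\<^sup>+x. h x * indicator {0..} x + h (- x) * indicator {..0} x \<partial>lborel)"
    by (intro nn_integral_cong_AE AE_I[of _ _ "{0}"]) (auto simp: indicator_def)
  also have "\<dots> = (\<integral>\<^sup>+x. h x * indicator {0..} x \<partial>lborel) + (\<integral>\<^sup>+x. h (- x) * indicator {..0} x \<partial>lborel)"
    by (intro nn_integral_add) auto
  also have "(\<integral>\<^sup>+x. h (- x) * indicator {..0} x \<partial>lborel) = (\<integral>\<^sup>+x. h x * indicator {0..} x \<partial>lborel)"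
    by (subst nn_integral_real_affine[of _ "-1" 0]) (auto simp: indicator_def intro!: nn_integral_cong)
  finally show ?thesis by (simp add: mult_2)
qed

lemma nn_integral_indicator_incseq_UN:
  fixes f :: "'a \<Rightarrow> ennreal"
  assumes [measurable]: "f \<in> borel_measurable M" and "range A \<subseteq> sets M" "incseq A"
  shows "(\<integral>\<^sup>+x. f x * indicator (\<Union>i. A i) x \<partial>M) = (SUP i. \<integral>\<^sup>+x. f x * indicator (A i) x \<partial>M)"
proof -
  have [measurable]: "A i \<in> sets M" for i using assms(2) by auto
  have "emeasure (density M f) (\<Union>i. A i) = (SUP i. emeasure (density M f) (A i))"
    using assms by (intro SUP_emeasure_incseq[symmetric]) auto
  then show ?thesis by (simp add: emeasure_density)
qed

lemma UN_atLeastAtMost_tendsto: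
  fixes b :: "'a::linorder_topology"
  assumes "c \<longlonglongrightarrow> b" "\<And>n. c n < b"
  shows "(\<Union>n. {a..c n}) = {a..<b}"
proof (intro equalityI subsetI)
  fix t assume "t \<in> {a..<b}"
  then have "eventually (\<lambda>n. t < c n) sequentially" using order_tendstoD(1)[OF assms(1)] by simp
  then obtain n where "t < c n" by (auto dest: eventually_happens)
  then show "t \<in> (\<Union>n. {a..c n})" using \<open>t \<in> {a..<b}\<close> by (auto intro: less_imp_le)
qed (use assms(2) in \<open>auto intro: le_less_trans\<close>)

lemma UN_atLeastAtMost_at_top:
  fixes h :: "nat \<Rightarrow> 'a::linorder"
  assumes "filterlim h at_top sequentially"
  shows "(\<Union>n. {a..h n}) = {a..}"
proof (intro equalityI subsetI)
  fix x assume "x \<in> {a..}"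
  moreover obtain n where "x \<le> h n"
    using assms unfolding filterlim_at_top by (auto dest!: spec[of _ x] eventually_happens)
  ultimately show "x \<in> (\<Union>n. {a..h n})" by auto
qed auto

lemma nn_integral_substitution_at_top:
  fixes f :: "real \<Rightarrow> ennreal" and g g' :: "real \<Rightarrow> real"
  assumes [measurable]: "f \<in> borel_measurable borel" "g \<in> borel_measurable borel" "g' \<in> borel_measurable borel"
    and "a < b"
    and deriv: "\<And>t. a \<le> t \<Longrightarrow> t < b \<Longrightarrow> (g has_real_derivative g' t) (at t)"
    and cont: "continuous_on {a..<b} g'" and nonneg: "\<And>t. a \<le> t \<Longrightarrow> t < b \<Longrightarrow> 0 \<le> g' t"
    and at_top: "filterlim g at_top (at_left b)"
  shows "(\<integral>\<^sup>+x. f x * indicator {g a..} x \<partial>lborel) = (\<integral>\<^sup>+t. f (g t) * g' t * indicator {a..<b} t \<partial>lborel)"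
proof -
  obtain c :: "nat \<Rightarrow> real" where incseq_c: "incseq c" and c_gt: "\<And>n. a < c n" and c_less: "\<And>n. c n < b"
    and c_lim: "c \<longlonglongrightarrow> b"
    using ereal_incseq_approx[of "ereal a" "ereal b"] \<open>a < b\<close> by auto
  have mono_g: "g s \<le> g t" if "a \<le> s" "s \<le> t" "t < b" for s t
  proof (rule DERIV_nonneg_imp_nondecreasing[OF that(2)])
    fix x assume "s \<le> x" "x \<le> t"
    then show "\<exists>y. (g has_real_derivative y) (at x) \<and> 0 \<le> y"
      using that deriv[of x] nonneg[of x] by auto
  qed
  have "filterlim c (at_left b) sequentially"
    using c_lim c_less by (simp add: tendsto_imp_filterlim_at_left)
  then have UN_g: "(\<Union>n. {g a..g (c n)}) = {g a..}"
    by (intro UN_atLeastAtMost_at_top filterlim_compose[OF at_top])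
  have "(\<integral>\<^sup>+x. f x * indicator {g a..} x \<partial>lborel) = (SUP n. \<integral>\<^sup>+x. f x * indicator {g a..g (c n)} x \<partial>lborel)"
    unfolding UN_g[symmetric]
  proof (rule nn_integral_indicator_incseq_UN)
    have "g (c m) \<le> g (c n)" if "m \<le> n" for m n
      by (rule mono_g[OF less_imp_le[OF c_gt] incseqD[OF incseq_c that] c_less])
    then show "incseq (\<lambda>n. {g a..g (c n)})"
      by (auto simp: incseq_def intro: order_trans)
  qed auto
  also have "\<dots> = (SUP n. \<integral>\<^sup>+t. f (g t) * g' t * indicator {a..c n} t \<partial>lborel)"
  proof (intro SUP_cong refl nn_integral_substitution_aux)
    fix n
    show "continuous_on {a..c n} g'"
      using c_less[of n] by (intro continuous_on_subset[OF cont]) auto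
    fix t assume "t \<in> {a..c n}"
    with c_less[of n] have "a \<le> t" "t < b" by auto
    then show "(g has_real_derivative g' t) (at t)" "0 \<le> g' t" by (fact deriv nonneg)+
  qed (use c_gt in auto)
  also have "\<dots> = (\<integral>\<^sup>+t. f (g t) * g' t * indicator {a..<b} t \<partial>lborel)"
    unfolding UN_atLeastAtMost_tendsto[OF c_lim c_less, symmetric]
  proof (rule nn_integral_indicator_incseq_UN[symmetric])
    show "incseq (\<lambda>n. {a..c n})"
      using incseq_c by (auto simp: incseq_def intro: order_trans)
  qed auto
  finally show ?thesis .
qed

lemma one_minus_square_bounds:
  fixes t :: real assumes "0 \<le> t" "t < 1" shows "0 < 1 - t\<^sup>2" "1 - t\<^sup>2 \<le> 1"
  using assms by (auto simp: power_less_one_iff)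

lemma DERIV_gnomonic:
  fixes t :: real
  assumes "0 \<le> t" "t < 1"
  shows "((\<lambda>t. t / sqrt (1 - t\<^sup>2)) has_real_derivative (1 - t\<^sup>2) powr (- 3/2)) (at t)"
proof -
  have pos: "1 - t\<^sup>2 > 0" by (rule one_minus_square_bounds[OF assms])
  have "((\<lambda>t. t / sqrt (1 - t\<^sup>2)) has_real_derivative (sqrt (1 - t\<^sup>2) + t\<^sup>2 / sqrt (1 - t\<^sup>2)) / (1 - t\<^sup>2)) (at t)"
    using pos by (auto intro!: derivative_eq_intros simp: field_simps power2_eq_square)
  also have "sqrt (1 - t\<^sup>2) + t\<^sup>2 / sqrt (1 - t\<^sup>2) = 1 / sqrt (1 - t\<^sup>2)"
    using pos by (simp add: field_simps)
  also have "1 / sqrt (1 - t\<^sup>2) / (1 - t\<^sup>2) = (1 - t\<^sup>2) powr (- 3/2)"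
  proof -
    have "(1 - t\<^sup>2) powr (3/2) = (1 - t\<^sup>2) powr (1/2) * (1 - t\<^sup>2) powr 1"
      unfolding powr_add[symmetric] by simp
    then show ?thesis using pos by (simp add: powr_minus powr_half_sqrt field_simps)
  qed
  finally show ?thesis .
qed

lemma filterlim_gnomonic_at_top: "filterlim (\<lambda>t::real. t / sqrt (1 - t\<^sup>2)) at_top (at_left 1)"
proof -
  have "((\<lambda>t::real. sqrt (1 - t\<^sup>2)) \<longlongrightarrow> sqrt (1 - 1\<^sup>2)) (at_left 1)"
    by (intro tendsto_intros)
  moreover have "eventually (\<lambda>t::real. sqrt (1 - t\<^sup>2) \<in> {0<..}) (at_left 1)"
    using eventually_at_left_real[of 0 1] by (rule eventually_mono) (auto simp: power_less_one_iff)
  ultimately have "filterlim (\<lambda>t::real. sqrt (1 - t\<^sup>2)) (at_right 0) (at_left 1)"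
    by (simp add: filterlim_at eventually_mono)
  then show ?thesis
    unfolding divide_inverse
    by (intro filterlim_tendsto_pos_mult_at_top[of _ 1] tendsto_ident_at
      filterlim_compose[OF filterlim_inverse_at_top_right]) auto
qed

lemma nn_integral_gnomonic_substitution:
  fixes G :: "real \<Rightarrow> ennreal" and s :: real
  assumes [measurable]: "G \<in> borel_measurable borel"
  shows "(\<integral>\<^sup>+\<tau>. G (\<tau> / sqrt (1 + \<tau>\<^sup>2)) * ennreal ((1 + \<tau>\<^sup>2) powr - s) * indicator {0..} \<tau> \<partial>lborel)
    = (\<integral>\<^sup>+t. G t * ennreal ((1 - t\<^sup>2) powr (s - 3/2)) * indicator {0..<1} t \<partial>lborel)"
proof -
  define f where "f \<tau> = G (\<tau> / sqrt (1 + \<tau>\<^sup>2)) * ennreal ((1 + \<tau>\<^sup>2) powr - s)" for \<tau> :: real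
  define g where "g t = t / sqrt (1 - t\<^sup>2)" for t :: real
  have "(\<integral>\<^sup>+\<tau>. f \<tau> * indicator {g 0..} \<tau> \<partial>lborel)
      = (\<integral>\<^sup>+t. f (g t) * ennreal ((1 - t\<^sup>2) powr (- 3/2)) * indicator {0..<1} t \<partial>lborel)"
  proof (rule nn_integral_substitution_at_top)
    show "continuous_on {0..<1} (\<lambda>t::real. (1 - t\<^sup>2) powr (- 3/2))"
      using one_minus_square_bounds(1) by (intro continuous_intros) force
    show "filterlim g at_top (at_left 1)"
      unfolding g_def by (rule filterlim_gnomonic_at_top)
    show "(g has_real_derivative (1 - t\<^sup>2) powr (- 3/2)) (at t)" if "0 \<le> t" "t < 1" for t
      unfolding g_def by (rule DERIV_gnomonic[OF that])
  qed (auto simp: f_def g_def)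
  also have "\<dots> = (\<integral>\<^sup>+t. G t * ennreal ((1 - t\<^sup>2) powr (s - 3/2)) * indicator {0..<1} t \<partial>lborel)"
  proof (rule nn_integral_cong)
    fix t :: real
    have "f (g t) * ennreal ((1 - t\<^sup>2) powr (- 3/2)) = G t * ennreal ((1 - t\<^sup>2) powr (s - 3/2))"
      if "0 \<le> t" "t < 1"
    proof -
      have pos: "1 - t\<^sup>2 > 0" by (rule one_minus_square_bounds[OF that])
      have one_plus_square: "1 + (g t)\<^sup>2 = 1 / (1 - t\<^sup>2)"
        using pos by (simp add: g_def field_simps power_divide)
      have "g t / sqrt (1 + (g t)\<^sup>2) = t"
        unfolding one_plus_square using pos by (simp add: g_def real_sqrt_divide)
      moreover have "(1 + (g t)\<^sup>2) powr - s = (1 - t\<^sup>2) powr s"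
        unfolding one_plus_square using pos by (simp add: powr_divide powr_minus)
      moreover have "(1 - t\<^sup>2) powr s * (1 - t\<^sup>2) powr (- 3/2) = (1 - t\<^sup>2) powr (s - 3/2)"
        unfolding powr_add[symmetric] by simp
      ultimately show ?thesis by (simp add: f_def mult.assoc ennreal_mult[symmetric])
    qed
    then show "f (g t) * ennreal ((1 - t\<^sup>2) powr (- 3/2)) * indicator {0..<1} t
        = G t * ennreal ((1 - t\<^sup>2) powr (s - 3/2)) * indicator {0..<1} t"
      by (simp split: split_indicator)
  qed
  finally show ?thesis by (simp add: f_def g_def)
qed

text \<open>The second parameter is normalised so that slice_measure 0 k belongs to the k-sphere.\<close>
definition slice_measure :: "real \<Rightarrow> real \<Rightarrow> real measure" where
  "slice_measure a b =
     density lborel (\<lambda>t. ennreal (t powr a * (1 - t\<^sup>2) powr (b / 2 - 1)) * indicator {0<..<1} t)"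

lemma sets_slice_measure [simp, measurable_cong]: "sets (slice_measure a b) = sets borel"
  by (simp add: slice_measure_def)

lemma space_slice_measure [simp]: "space (slice_measure a b) = UNIV"
  by (simp add: slice_measure_def)

lemma nn_integral_slice_measure:
  assumes [measurable]: "G \<in> borel_measurable borel"
  shows "(\<integral>\<^sup>+t. G t \<partial>slice_measure a b) =
    (\<integral>\<^sup>+t. ennreal (t powr a * (1 - t\<^sup>2) powr (b / 2 - 1)) * G t * indicator {0<..<1} t \<partial>lborel)"
  unfolding slice_measure_def by (subst nn_integral_density) (auto simp: mult_ac)

lemma emeasure_slice_measure:
  assumes [measurable]: "E \<in> sets borel"
  shows "emeasure (slice_measure a b) E =
    (\<integral>\<^sup>+t. ennreal (t powr a * (1 - t\<^sup>2) powr (b / 2 - 1)) * indicator E t * indicator {0<..<1} t \<partial>lborel)"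
  unfolding slice_measure_def by (subst emeasure_density) (auto simp: mult_ac)

text \<open>Two hemispheres over an equator of area unit_ball_vol (N - 1) * (N - 1).\<close>
definition slice_const :: "nat \<Rightarrow> real" where
  "slice_const N = 2 * unit_ball_vol (real N - 1) * (real N - 1)"

lemma slice_const_pos: "N \<ge> 2 \<Longrightarrow> slice_const N > 0"
  by (simp add: slice_const_def)

lemma nn_integral_sphere_slice_Basis:
  fixes e :: "'a::euclidean_space" and G :: "real \<Rightarrow> ennreal"
  assumes e_Basis: "e \<in> Basis" and dim_ge_2: "DIM('a) \<ge> 2" and G_meas [measurable]: "G \<in> borel_measurable borel"
  shows "(\<integral>\<^sup>+y. G \<bar>y \<bullet> e\<bar> \<partial>sphere_measure) =
    ennreal (slice_const DIM('a)) * (\<integral>\<^sup>+t. G t \<partial>slice_measure 0 (real DIM('a) - 1))"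
proof -
  define V where "V = unit_ball_vol (real DIM('a) - 1) * (real DIM('a) - 1) / DIM('a)"
  have V_nonneg: "V \<ge> 0" using dim_ge_2 by (simp add: V_def)
  have "(\<integral>\<^sup>+y. G \<bar>y \<bullet> e\<bar> \<partial>sphere_measure) =
      of_nat DIM('a) * (\<integral>\<^sup>+y. G \<bar>(y /\<^sub>R norm y) \<bullet> e\<bar> * indicator (ball 0 1 - {0}) y \<partial>lborel)"
    by (rule nn_integral_sphere_measure) measurable
  also have "(\<integral>\<^sup>+y. G \<bar>(y /\<^sub>R norm y) \<bullet> e\<bar> * indicator (ball 0 1 - {0}) y \<partial>lborel) = ennreal V *
      (\<integral>\<^sup>+\<tau>. G (\<bar>\<tau>\<bar> / sqrt (1 + \<bar>\<tau>\<bar>\<^sup>2)) * ennreal ((1 + \<bar>\<tau>\<bar>\<^sup>2) powr - (real DIM('a) / 2)) \<partial>lborel)"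
    using dim_ge_2 by (subst nn_integral_ball_direction[OF e_Basis]) (auto simp: V_def of_nat_diff)
  also have "(\<integral>\<^sup>+\<tau>. G (\<bar>\<tau>\<bar> / sqrt (1 + \<bar>\<tau>\<bar>\<^sup>2)) * ennreal ((1 + \<bar>\<tau>\<bar>\<^sup>2) powr - (real DIM('a) / 2)) \<partial>lborel)
      = 2 * (\<integral>\<^sup>+\<tau>. G (\<tau> / sqrt (1 + \<tau>\<^sup>2)) *
          ennreal ((1 + \<tau>\<^sup>2) powr - (real DIM('a) / 2)) * indicator {0..} \<tau> \<partial>lborel)"
    by (rule nn_integral_even) measurable
  also have "\<dots>
      = 2 * (\<integral>\<^sup>+t. G t * ennreal ((1 - t\<^sup>2) powr (real DIM('a) / 2 - 3/2)) * indicator {0..<1} t \<partial>lborel)"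
    by (subst nn_integral_gnomonic_substitution) auto
  also have "(\<integral>\<^sup>+t. G t * ennreal ((1 - t\<^sup>2) powr (real DIM('a) / 2 - 3/2)) * indicator {0..<1} t \<partial>lborel)
      = (\<integral>\<^sup>+t. G t \<partial>slice_measure 0 (real DIM('a) - 1))"
    unfolding nn_integral_slice_measure[OF G_meas]
    by (intro nn_integral_cong_AE AE_I[of _ _ "{0}"])
       (auto simp: indicator_def diff_divide_distrib mult.commute)
  finally have "(\<integral>\<^sup>+y. G \<bar>y \<bullet> e\<bar> \<partial>sphere_measure) =
      (of_nat DIM('a) * ennreal V * 2) * (\<integral>\<^sup>+t. G t \<partial>slice_measure 0 (real DIM('a) - 1))"
    by (simp only: mult.assoc)
  moreover have "of_nat DIM('a) * ennreal V * 2 = ennreal (real DIM('a) * V * 2)"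
    using V_nonneg by (simp add: ennreal_mult ennreal_of_nat_eq_real_of_nat)
  moreover have "real DIM('a) * V * 2 = slice_const DIM('a)"
    by (simp add: slice_const_def V_def)
  ultimately show ?thesis by simp
qed

lemma nn_integral_sphere_measure_orthogonal_transformation:
  fixes T :: "'a::euclidean_space \<Rightarrow> 'a"
  assumes "orthogonal_transformation T" and [measurable]: "g \<in> borel_measurable borel"
  shows "(\<integral>\<^sup>+y. g (T y) \<partial>sphere_measure) = (\<integral>\<^sup>+y. g y \<partial>sphere_measure)"
proof -
  have linear_T: "linear T" and norm_T: "norm (T x) = norm x" for x
    using assms(1) by (auto simp: orthogonal_transformation)
  have [measurable]: "T \<in> borel_measurable borel"
    using linear_T by (rule borel_measurable_linear)
  have [measurable]: "ball 0 1 - {0} \<in> sets (borel :: 'a measure)" by simp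
  have "T x = 0 \<longleftrightarrow> x = 0" for x by (metis norm_T norm_eq_zero)
  then have "g (T (y /\<^sub>R norm y)) * indicator (ball 0 1 - {0}) y
      = g (T y /\<^sub>R norm (T y)) * indicator (ball 0 1 - {0}) (T y)" for y
    by (simp add: norm_T linear_scale[OF linear_T] indicator_def)
  then have "(\<integral>\<^sup>+y. g (T (y /\<^sub>R norm y)) * indicator (ball 0 1 - {0}) y \<partial>lborel)
      = (\<integral>\<^sup>+y. g (y /\<^sub>R norm y) * indicator (ball 0 1 - {0}) y \<partial>distr lborel borel T)"
    by (simp add: nn_integral_distr)
  then show ?thesis
    by (simp add: nn_integral_sphere_measure distr_lborel_orthogonal_transformation[OF assms(1)])
qed

lemma nn_integral_sphere_slice:
  fixes w :: "real^'n" and G :: "real \<Rightarrow> ennreal"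
  assumes dim_ge_2: "CARD('n) \<ge> 2" and [measurable]: "G \<in> borel_measurable borel"
  shows "(\<integral>\<^sup>+y. G \<bar>y \<bullet> w\<bar> \<partial>sphere_measure) =
    ennreal (slice_const CARD('n)) * (\<integral>\<^sup>+t. G (norm w * t) \<partial>slice_measure 0 (real CARD('n) - 1))"
proof -
  obtain b :: "real^'n" where b_Basis: "b \<in> Basis" using nonempty_Basis by blast
  then obtain T where T: "orthogonal_transformation T" and T_b: "T (norm w *\<^sub>R b) = w"
    using orthogonal_transformation_exists[of "norm w *\<^sub>R b" w] by auto
  have "T y \<bullet> w = norm w * (y \<bullet> b)" for y
    using T T_b unfolding orthogonal_transformation_def by (metis inner_scaleR_right)
  then have "(\<integral>\<^sup>+y. G \<bar>y \<bullet> w\<bar> \<partial>sphere_measure) = (\<integral>\<^sup>+y. G (norm w * \<bar>y \<bullet> b\<bar>) \<partial>sphere_measure)"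
    using nn_integral_sphere_measure_orthogonal_transformation[OF T, of "\<lambda>y. G \<bar>y \<bullet> w\<bar>"]
    by (simp add: abs_mult)
  also have "\<dots> = ennreal (slice_const CARD('n)) * (\<integral>\<^sup>+t. G (norm w * t) \<partial>slice_measure 0 (real CARD('n) - 1))"
    using nn_integral_sphere_slice_Basis[OF b_Basis, of "\<lambda>t. G (norm w * t)"] dim_ge_2 by simp
  finally show ?thesis .
qed

section \<open>Lorentz norms\<close>

lemma enn_powr_ennreal: "0 \<le> x \<Longrightarrow> enn_powr (ennreal x) r = ennreal (x powr r)"
  by (simp add: enn_powr_def)

lemma enn_powr_top [simp]: "enn_powr top r = top"
  by (simp add: enn_powr_def)

lemma enn_powr_0 [simp]: "enn_powr 0 r = 0"
  by (simp add: enn_powr_def)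

lemma enn_powr_mono:
  assumes "0 \<le> r" "x \<le> y"
  shows "enn_powr x r \<le> enn_powr y r"
proof (cases "y = top")
  case False
  then obtain a b where "x = ennreal a" "0 \<le> a" "y = ennreal b" "0 \<le> b"
    using assms(2) by (cases x; cases y) (auto simp: top_unique)
  then show ?thesis using assms by (simp add: enn_powr_ennreal powr_mono2 ennreal_leI)
qed simp

lemma enn_powr_mult_ennreal:
  assumes "0 < c"
  shows "enn_powr (ennreal c * x) r = ennreal (c powr r) * enn_powr x r"
proof (cases x)
  case (real a)
  then show ?thesis using assms by (simp add: enn_powr_ennreal powr_mult flip: ennreal_mult)
next
  case top
  then show ?thesis using assms by (simp add: ennreal_mult_top)
qed


lemma borel_measurable_antimono_ennreal:
  fixes h :: "real \<Rightarrow> ennreal"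
  assumes "antimono h"
  shows "h \<in> borel_measurable borel"
proof (rule borel_measurableI_greater)
  fix y
  have "is_interval {s. y < h s}"
    using assms unfolding is_interval_1 by (auto dest: antimonoD intro: less_le_trans)
  then show "{s \<in> space borel. y < h s} \<in> sets borel"
    by (simp add: real_interval_borel_measurable)
qed

lemma antimono_emeasure_distribution:
  fixes f :: "'a \<Rightarrow> real"
  assumes [measurable]: "f \<in> borel_measurable M"
  shows "antimono (\<lambda>s. emeasure M {x \<in> space M. s < \<bar>f x\<bar>})"
  by (intro antimonoI emeasure_mono) auto

lemma lorentz_norm_scaled_distribution:
  fixes f :: "'a \<Rightarrow> real" and g :: "'b \<Rightarrow> real"
  assumes "0 < p" and c_pos: "0 < c" and [measurable]: "g \<in> borel_measurable N"
    and distribution: "\<And>s. 0 \<le> s \<Longrightarrow>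
      emeasure M {x \<in> space M. s < \<bar>f x\<bar>} = ennreal c * emeasure N {x \<in> space N. s < \<bar>g x\<bar>}"
  shows "lorentz_norm M p f = ennreal (c powr (1 / p)) * lorentz_norm N p g"
proof -
  let ?h = "\<lambda>s. enn_powr (emeasure N {x \<in> space N. s < \<bar>g x\<bar>}) (1 / p)"
  have [measurable]: "?h \<in> borel_measurable borel"
    using \<open>0 < p\<close> antimono_emeasure_distribution[of g N]
    by (intro borel_measurable_antimono_ennreal) (auto simp: antimono_def intro: enn_powr_mono)
  have "(\<integral>\<^sup>+s\<in>{0..}. enn_powr (emeasure M {x \<in> space M. s < \<bar>f x\<bar>}) (1 / p) \<partial>lborel)
      = (\<integral>\<^sup>+s. ennreal (c powr (1 / p)) * (?h s * indicator {0..} s) \<partial>lborel)"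
    by (intro nn_integral_cong)
       (auto simp: distribution enn_powr_mult_ennreal[OF c_pos] mult.assoc split: split_indicator)
  also have "\<dots> = ennreal (c powr (1 / p)) * (\<integral>\<^sup>+s\<in>{0..}. ?h s \<partial>lborel)"
    by (rule nn_integral_cmult) measurable
  finally show ?thesis by (simp add: lorentz_norm_def mult_ac)
qed

lemma lorentz_norm_indicator:
  assumes "0 < p" "E \<in> sets M"
  shows "lorentz_norm M p (indicator E) = ennreal p * enn_powr (emeasure M E) (1 / p)"
proof -
  have "{x \<in> space M. s < \<bar>indicator E x :: real\<bar>} = (if s < 1 then E else {})" if "0 \<le> s" for s
    using that sets.sets_into_space[OF assms(2)] by (auto split: split_indicator)
  then have "(\<integral>\<^sup>+s\<in>{0..}. enn_powr (emeasure M {x \<in> space M. s < \<bar>indicator E x :: real\<bar>}) (1 / p) \<partial>lborel)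
      = (\<integral>\<^sup>+s. enn_powr (emeasure M E) (1 / p) * indicator {0..<1::real} s \<partial>lborel)"
    by (intro nn_integral_cong) (auto split: split_indicator)
  then show ?thesis by (simp add: lorentz_norm_def nn_integral_cmult)
qed

lemma nn_integral_layer_cake:
  fixes f :: "'a \<Rightarrow> real"
  assumes sigma_finite: "sigma_finite_measure M" and [measurable]: "f \<in> borel_measurable M"
  shows "(\<integral>\<^sup>+x. ennreal \<bar>f x\<bar> \<partial>M) = (\<integral>\<^sup>+s\<in>{0..}. emeasure M {x \<in> space M. s < \<bar>f x\<bar>} \<partial>lborel)"
proof -
  interpret sigma_finite_measure M by (rule sigma_finite)
  interpret P: pair_sigma_finite M "lborel :: real measure" ..
  have "(\<integral>\<^sup>+x. ennreal \<bar>f x\<bar> \<partial>M)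
      = (\<integral>\<^sup>+x. (\<integral>\<^sup>+s. indicator {z. 0 \<le> snd z \<and> snd z < \<bar>f (fst z)\<bar>} (x, s) \<partial>lborel) \<partial>M)"
  proof (rule nn_integral_cong)
    fix x
    have "(\<integral>\<^sup>+s. indicator {z. 0 \<le> snd z \<and> snd z < \<bar>f (fst z)\<bar>} (x, s) \<partial>lborel)
        = (\<integral>\<^sup>+s. indicator {0..<\<bar>f x\<bar>} s \<partial>lborel)"
      by (intro nn_integral_cong) (auto split: split_indicator)
    then show "ennreal \<bar>f x\<bar> = (\<integral>\<^sup>+s. indicator {z. 0 \<le> snd z \<and> snd z < \<bar>f (fst z)\<bar>} (x, s) \<partial>lborel)"
      by simp
  qed
  also have "\<dots> = (\<integral>\<^sup>+s. (\<integral>\<^sup>+x. indicator {z. 0 \<le> snd z \<and> snd z < \<bar>f (fst z)\<bar>} (x, s) \<partial>M) \<partial>lborel)"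
    by (rule P.Fubini'[symmetric]) measurable
  also have "\<dots> = (\<integral>\<^sup>+s\<in>{0..}. emeasure M {x \<in> space M. s < \<bar>f x\<bar>} \<partial>lborel)"
  proof (rule nn_integral_cong)
    fix s :: real
    have "(\<integral>\<^sup>+x. indicator {z. 0 \<le> snd z \<and> snd z < \<bar>f (fst z)\<bar>} (x, s) \<partial>M)
        = (\<integral>\<^sup>+x. indicator {x \<in> space M. s < \<bar>f x\<bar>} x * indicator {0..} s \<partial>M)"
      by (intro nn_integral_cong) (auto split: split_indicator)
    then show "(\<integral>\<^sup>+x. indicator {z. 0 \<le> snd z \<and> snd z < \<bar>f (fst z)\<bar>} (x, s) \<partial>M)
        = emeasure M {x \<in> space M. s < \<bar>f x\<bar>} * indicator {0..} s"
      by (simp add: nn_integral_multc)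
  qed
  finally show ?thesis .
qed

lemma nn_integral_le_lorentz_norm:
  fixes f :: "'a \<Rightarrow> real"
  assumes sigma_finite: "sigma_finite_measure L" and sets_L: "sets L = sets M"
    and [measurable]: "f \<in> borel_measurable M"
    and restricted: "\<And>E. E \<in> sets M \<Longrightarrow> ennreal b * emeasure L E \<le> enn_powr (emeasure M E) (1 / p)"
  shows "ennreal p * (ennreal b * (\<integral>\<^sup>+x. ennreal \<bar>f x\<bar> \<partial>L)) \<le> lorentz_norm M p f"
proof -
  let ?E = "\<lambda>s. {x \<in> space M. s < \<bar>f x\<bar>}"
  have f_meas: "f \<in> borel_measurable L" by (subst measurable_cong_sets[OF sets_L refl]) measurable
  have space_L: "space L = space M" using sets_L by (rule sets_eq_imp_space_eq)
  have [measurable]: "(\<lambda>s. emeasure L (?E s)) \<in> borel_measurable borel"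
    unfolding space_L[symmetric]
    by (intro borel_measurable_antimono_ennreal antimono_emeasure_distribution f_meas)
  have "ennreal b * (\<integral>\<^sup>+x. ennreal \<bar>f x\<bar> \<partial>L)
      = (\<integral>\<^sup>+s. ennreal b * emeasure L (?E s) * indicator {0..} s \<partial>lborel)"
    unfolding nn_integral_layer_cake[OF sigma_finite f_meas] space_L
    by (subst nn_integral_cmult[symmetric]) (simp_all add: mult.assoc)
  also have "\<dots> \<le> (\<integral>\<^sup>+s\<in>{0..}. enn_powr (emeasure M (?E s)) (1 / p) \<partial>lborel)"
    by (intro nn_integral_mono mult_right_mono restricted) auto
  finally show ?thesis unfolding lorentz_norm_def by (rule mult_left_mono) simp
qed

section \<open>The one-dimensional inequality\<close>

lemma emeasure_slice_measure_Int_unit: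
  assumes [measurable]: "E \<in> sets borel"
  shows "emeasure (slice_measure a b) (E \<inter> {0<..<1}) = emeasure (slice_measure a b) E"
  by (simp add: emeasure_slice_measure) (auto intro!: nn_integral_cong split: split_indicator)

lemma emeasure_slice_measure_mono:
  assumes [measurable]: "E \<in> sets borel"
    and density_le: "\<And>t. \<lbrakk>t \<in> E; 0 < t; t < 1\<rbrakk> \<Longrightarrow>
      t powr a * (1 - t\<^sup>2) powr (b / 2 - 1) \<le> h * (t powr a' * (1 - t\<^sup>2) powr (b' / 2 - 1))"
    and "0 \<le> h"
  shows "emeasure (slice_measure a b) E \<le> ennreal h * emeasure (slice_measure a' b') E"
proof -
  have "emeasure (slice_measure a b) E \<le> (\<integral>\<^sup>+t. ennreal h *
      (ennreal (t powr a' * (1 - t\<^sup>2) powr (b' / 2 - 1)) * indicator E t * indicator {0<..<1} t) \<partial>lborel)"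
    unfolding emeasure_slice_measure[OF assms(1)] using density_le \<open>0 \<le> h\<close>
    by (intro nn_integral_mono) (auto simp: ennreal_mult[symmetric] intro!: ennreal_leI split: split_indicator)
  then show ?thesis by (simp add: emeasure_slice_measure nn_integral_cmult)
qed

lemma emeasure_slice_measure_le:
  assumes [measurable]: "E \<in> sets borel"
    and density_le: "\<And>t. \<lbrakk>t \<in> E; 0 < t; t < 1\<rbrakk> \<Longrightarrow> t powr a * (1 - t\<^sup>2) powr (b / 2 - 1) \<le> h"
  shows "emeasure (slice_measure a b) E \<le> ennreal h * emeasure lborel E"
proof -
  have "emeasure (slice_measure a b) E \<le> (\<integral>\<^sup>+t. ennreal h * indicator E t \<partial>lborel)"
    unfolding emeasure_slice_measure[OF assms(1)] using density_le
    by (intro nn_integral_mono) (auto intro!: ennreal_leI split: split_indicator)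
  then show ?thesis by (simp add: nn_integral_cmult)
qed

lemma one_minus_square_powr_le:
  fixes t b :: real
  assumes "0 \<le> t" "t \<le> 1/2" "-1 \<le> b"
  shows "(1 - t\<^sup>2) powr b \<le> 4/3"
proof -
  have "t\<^sup>2 \<le> (1/2)\<^sup>2" using assms by (intro power_mono) auto
  then have three_quarters_le: "3/4 \<le> 1 - t\<^sup>2" by (simp add: power2_eq_square)
  have "(1 - t\<^sup>2) powr b \<le> (1 - t\<^sup>2) powr (-1)" using three_quarters_le assms by (intro powr_mono') auto
  also have "\<dots> \<le> 4/3" using three_quarters_le by (simp add: powr_minus field_simps)
  finally show ?thesis .
qed

lemma nn_integral_one_minus_square_powr:
  fixes a \<kappa> :: real
  assumes "0 \<le> a" "a \<le> 1" "\<kappa> > 0"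
  shows "(\<integral>\<^sup>+u. ennreal (u * (1 - u\<^sup>2) powr (\<kappa> - 1)) * indicator {a..1} u \<partial>lborel)
    = ennreal ((1 - a\<^sup>2) powr \<kappa> / (2 * \<kappa>))"
proof -
  have "((\<lambda>u. u * (1 - u\<^sup>2) powr (\<kappa> - 1)) has_integral
      (- ((1 - 1\<^sup>2) powr \<kappa> / (2 * \<kappa>)) - (- ((1 - a\<^sup>2) powr \<kappa> / (2 * \<kappa>))))) {a..1}"
  proof (rule fundamental_theorem_of_calculus_interior)
    show "a \<le> 1" by fact
    show "continuous_on {a..1} (\<lambda>u. - ((1 - u\<^sup>2) powr \<kappa> / (2 * \<kappa>)))"
      using assms by (intro continuous_intros continuous_on_powr') (auto simp: power_le_one)
    fix u assume u: "u \<in> {a<..<1}"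
    then have pos: "1 - u\<^sup>2 > 0" using \<open>0 \<le> a\<close> one_minus_square_bounds[of u] by auto
    have "((\<lambda>u. - ((1 - u\<^sup>2) powr \<kappa> / (2 * \<kappa>))) has_real_derivative
        - (\<kappa> * (1 - u\<^sup>2) powr (\<kappa> - 1) * (- (2 * u)) / (2 * \<kappa>))) (at u)"
      using pos \<open>\<kappa> > 0\<close> by (auto intro!: derivative_eq_intros simp: powr_diff field_simps)
    then show "((\<lambda>u. - ((1 - u\<^sup>2) powr \<kappa> / (2 * \<kappa>))) has_vector_derivative u * (1 - u\<^sup>2) powr (\<kappa> - 1)) (at u)"
      using \<open>\<kappa> > 0\<close> by (simp add: has_real_derivative_iff_has_vector_derivative mult_ac)
  qed
  then have "((\<lambda>u. u * (1 - u\<^sup>2) powr (\<kappa> - 1)) has_integral (1 - a\<^sup>2) powr \<kappa> / (2 * \<kappa>)) {a..1}"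
    by simp
  from nn_integral_has_integral_lebesgue[OF _ this] show ?thesis
    using \<open>0 \<le> a\<close> by (simp add: mult.commute ennreal_mult' ennreal_indicator)
qed

lemma emeasure_slice_measure_1_end:
  assumes "0 \<le> a" "a \<le> 1" "k > 0"
  shows "emeasure (slice_measure 1 k) {a<..<1} = ennreal ((1 - a\<^sup>2) powr (k / 2) / k)"
proof -
  have "emeasure (slice_measure 1 k) {a<..<1}
      = (\<integral>\<^sup>+u. ennreal (u * (1 - u\<^sup>2) powr (k / 2 - 1)) * indicator {a..1} u \<partial>lborel)"
    unfolding emeasure_slice_measure[OF greaterThanLessThan_borel] using assms
    by (intro nn_integral_cong_AE AE_I[of _ _ "{a, 1}"])
       (auto simp: emeasure_lborel_countable split: split_indicator)
  then show ?thesis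
    using nn_integral_one_minus_square_powr[of a "k / 2"] assms by simp
qed

lemma emeasure_slice_measure_end_ge:
  assumes "0 \<le> a" "a \<le> 1" "k > 0"
  shows "ennreal ((1 - a\<^sup>2) powr (k / 2) / k) \<le> emeasure (slice_measure 0 k) {a<..<1}"
  unfolding emeasure_slice_measure_1_end[OF assms, symmetric]
  using emeasure_slice_measure_mono[of "{a<..<1}" 1 k 1 0 k] by (simp add: mult_left_le_one_le)

lemma emeasure_slice_measure_end_le:
  assumes "1/2 \<le> a" "a \<le> 1" "k > 0"
  shows "emeasure (slice_measure 0 k) {a<..<1} \<le> ennreal (2 * (1 - a\<^sup>2) powr (k / 2) / k)"
proof -
  have "emeasure (slice_measure 0 k) {a<..<1} \<le> ennreal 2 * emeasure (slice_measure 1 k) {a<..<1}"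
  proof (rule emeasure_slice_measure_mono)
    fix t assume "t \<in> {a<..<1}" "0 < t" "t < 1"
    then show "t powr 0 * (1 - t\<^sup>2) powr (k / 2 - 1) \<le> 2 * (t powr 1 * (1 - t\<^sup>2) powr (k / 2 - 1))"
      using assms mult_right_mono[of 1 "2 * t" "(1 - t\<^sup>2) powr (k / 2 - 1)"] by auto
  qed auto
  also have "\<dots> = ennreal 2 * ennreal ((1 - a\<^sup>2) powr (k / 2) / k)"
    using assms by (subst emeasure_slice_measure_1_end) auto
  also have "\<dots> = ennreal (2 * ((1 - a\<^sup>2) powr (k / 2) / k))"
    using assms by (intro ennreal_mult[symmetric]) auto
  finally show ?thesis by simp
qed

text \<open>The (p - 1)-st power of this weight is the density of slice_measure (p - 1) (p * k) with respect to
  slice_measure 0 k.\<close>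
definition slice_weight :: "real \<Rightarrow> real \<Rightarrow> real" where
  "slice_weight k u = u * (1 - u\<^sup>2) powr (k / 2)"

lemma borel_measurable_slice_weight [measurable]: "slice_weight k \<in> borel_measurable borel"
  unfolding slice_weight_def by measurable

lemma emeasure_slice_sublevel_left:
  assumes k_pos: "k > 0" and \<epsilon>_pos: "\<epsilon> > 0"
  shows "emeasure (slice_measure 0 k) ({u. slice_weight k u < \<epsilon>} \<inter> {..1/2})
    \<le> ennreal (4/3 * (4/3) powr (k / 2) * \<epsilon>)"
proof -
  define r where "r = (4/3) powr (k / 2) * \<epsilon>"
  have r_pos: "r > 0" using \<epsilon>_pos by (simp add: r_def)
  let ?S = "{u. slice_weight k u < \<epsilon>} \<inter> {..1/2}"
  have "u < r" if "u \<in> ?S" "0 < u" for u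
  proof -
    have "u\<^sup>2 \<le> (1/2)\<^sup>2" using that by (intro power_mono) auto
    then have "(3/4) powr (k / 2) \<le> (1 - u\<^sup>2) powr (k / 2)"
      using k_pos by (intro powr_mono2) (auto simp: power2_eq_square)
    then have "u * (3/4) powr (k / 2) \<le> slice_weight k u"
      unfolding slice_weight_def using that by (intro mult_left_mono) auto
    also have "\<dots> < \<epsilon>" using that by simp
    finally have "u * (3/4) powr (k / 2) * (4/3) powr (k / 2) < r"
      by (simp add: r_def mult.commute)
    then show "u < r" by (simp add: mult.assoc flip: powr_mult)
  qed
  then have "?S \<inter> {0<..<1} \<subseteq> {0<..<r} \<inter> {..1/2}" by auto
  then have "emeasure (slice_measure 0 k) (?S \<inter> {0<..<1}) \<le> emeasure (slice_measure 0 k) ({0<..<r} \<inter> {..1/2})"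
    by (rule emeasure_mono) simp
  also have "\<dots> \<le> ennreal (4/3) * emeasure lborel ({0<..<r} \<inter> {..1/2})"
  proof (rule emeasure_slice_measure_le)
    fix t assume "t \<in> {0<..<r} \<inter> {..1/2}" "0 < t" "t < 1"
    then show "t powr 0 * (1 - t\<^sup>2) powr (k / 2 - 1) \<le> 4/3"
      using one_minus_square_powr_le[of t "k / 2 - 1"] k_pos by simp
  qed simp
  also have "\<dots> \<le> ennreal (4/3) * emeasure lborel {0<..<r}"
    by (intro mult_left_mono emeasure_mono) auto
  finally show ?thesis
    using r_pos by (simp add: emeasure_slice_measure_Int_unit r_def ennreal_mult[symmetric] mult.assoc)
qed

lemma emeasure_slice_sublevel_right:
  assumes k_pos: "k > 0" and \<epsilon>_pos: "\<epsilon> > 0"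
  shows "emeasure (slice_measure 0 k) ({u. slice_weight k u < \<epsilon>} \<inter> {1/2<..}) \<le> ennreal (4 / k * \<epsilon>)"
proof -
  define v where "v = (2 * \<epsilon>) powr (2 / k)"
  have v_pos: "v > 0" and v_powr: "v powr (k / 2) = 2 * \<epsilon>" using \<epsilon>_pos k_pos by (auto simp: v_def powr_powr)
  define a where "a = sqrt (1 - min (3/4) v)"
  have "1/2 \<le> a"
    unfolding a_def by (rule real_le_rsqrt) (auto simp: power2_eq_square min_def)
  then have a_bounds: "1/2 \<le> a" "a \<le> 1" and a_square: "1 - a\<^sup>2 = min (3/4) v"
    using v_pos by (auto simp: a_def min_def)
  let ?S = "{u. slice_weight k u < \<epsilon>} \<inter> {1/2<..}"
  have "a < u" if u: "u \<in> ?S" "u < 1" for u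
  proof -
    have bounds: "0 \<le> 1 - u\<^sup>2" "1 - u\<^sup>2 < 3/4"
      using u one_minus_square_bounds[of u] power_strict_mono[of "1/2" u 2] by (auto simp: power2_eq_square)
    have "1/2 * (1 - u\<^sup>2) powr (k / 2) \<le> slice_weight k u"
      unfolding slice_weight_def using u by (intro mult_right_mono) auto
    also have "\<dots> < \<epsilon>" using u by simp
    finally have "(1 - u\<^sup>2) powr (k / 2) < v powr (k / 2)" using v_powr by simp
    then have "1 - u\<^sup>2 < v"
      using v_pos k_pos by (meson not_less powr_mono2 less_imp_le divide_pos_pos zero_less_numeral)
    then have "a\<^sup>2 < u\<^sup>2" using a_square bounds by linarith
    then show "a < u" using u by (auto intro: power2_less_imp_less)
  qed
  then have "?S \<inter> {0<..<1} \<subseteq> {a<..<1}" by auto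
  then have "emeasure (slice_measure 0 k) (?S \<inter> {0<..<1}) \<le> emeasure (slice_measure 0 k) {a<..<1}"
    by (rule emeasure_mono) simp
  also have "\<dots> \<le> ennreal (2 * (1 - a\<^sup>2) powr (k / 2) / k)"
    using a_bounds k_pos by (intro emeasure_slice_measure_end_le) auto
  also have "\<dots> \<le> ennreal (4 / k * \<epsilon>)"
  proof (rule ennreal_leI)
    have "(1 - a\<^sup>2) powr (k / 2) \<le> v powr (k / 2)" using a_square v_pos k_pos by (intro powr_mono2) auto
    then show "2 * (1 - a\<^sup>2) powr (k / 2) / k \<le> 4 / k * \<epsilon>" using k_pos v_powr by (simp add: field_simps)
  qed
  finally show ?thesis by (simp add: emeasure_slice_measure_Int_unit)
qed

lemma emeasure_slice_sublevel:
  assumes k_pos: "k > 0"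
  obtains C where "C > 0"
    and "\<And>\<epsilon>. \<epsilon> > 0 \<Longrightarrow> emeasure (slice_measure 0 k) {u. slice_weight k u < \<epsilon>} \<le> ennreal (C * \<epsilon>)"
proof
  let ?A = "4/3 * (4/3) powr (k / 2)"
  show "?A + 4 / k > 0" using k_pos by (intro add_pos_pos) auto
  fix \<epsilon> :: real assume \<epsilon>_pos: "\<epsilon> > 0"
  let ?S = "{u. slice_weight k u < \<epsilon>}"
  have "?S = (?S \<inter> {..1/2}) \<union> (?S \<inter> {1/2<..})" by auto
  then have "emeasure (slice_measure 0 k) ?S
      \<le> emeasure (slice_measure 0 k) (?S \<inter> {..1/2}) + emeasure (slice_measure 0 k) (?S \<inter> {1/2<..})"
    using emeasure_subadditive[of "?S \<inter> {..1/2}" "slice_measure 0 k" "?S \<inter> {1/2<..}"] by simp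
  also have "\<dots> \<le> ennreal (?A * \<epsilon>) + ennreal (4 / k * \<epsilon>)"
    by (intro add_mono emeasure_slice_sublevel_left emeasure_slice_sublevel_right k_pos \<epsilon>_pos)
  also have "\<dots> = ennreal ((?A + 4 / k) * \<epsilon>)"
    using k_pos \<epsilon>_pos by (simp add: distrib_right flip: ennreal_plus)
  finally show "emeasure (slice_measure 0 k) ?S \<le> ennreal ((?A + 4 / k) * \<epsilon>)" .
qed

lemma finite_slice_measure:
  assumes k_pos: "k > 0"
  shows "finite_measure (slice_measure 0 k)"
proof
  have "slice_weight k u < 2" if "0 < u" "u < 1" for u
  proof -
    have "(1 - u\<^sup>2) powr (k / 2) \<le> 1"
      using one_minus_square_bounds[of u] that k_pos by (intro powr_le1) auto
    then have "slice_weight k u \<le> 1 * 1" unfolding slice_weight_def using that by (intro mult_mono) auto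
    then show ?thesis by simp
  qed
  then have "{0<..<1} \<subseteq> {u. slice_weight k u < 2}" by auto
  then have "emeasure (slice_measure 0 k) {0<..<1} \<le> emeasure (slice_measure 0 k) {u. slice_weight k u < 2}"
    by (rule emeasure_mono) simp
  moreover obtain C where "emeasure (slice_measure 0 k) {u. slice_weight k u < 2} \<le> ennreal (C * 2)"
    using emeasure_slice_sublevel[OF k_pos] by (metis zero_less_numeral)
  ultimately show "emeasure (slice_measure 0 k) (space (slice_measure 0 k)) \<noteq> \<infinity>"
    using emeasure_slice_measure_Int_unit[of UNIV 0 k] by (auto simp: top_unique)
qed

text \<open>At least half of the mass of E sits where q is at least a multiple of that mass.\<close>
lemma (in finite_measure) nn_integral_powr_ge_of_sublevel:
  fixes q :: "'a \<Rightarrow> real"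
  assumes [measurable]: "q \<in> borel_measurable M" and C_pos: "C > 0" and p_ge_1: "p \<ge> 1"
    and sublevel: "\<And>\<epsilon>. \<epsilon> > 0 \<Longrightarrow> measure M {x \<in> space M. q x < \<epsilon>} \<le> C * \<epsilon>"
    and E_sets [measurable]: "E \<in> sets M"
  shows "ennreal ((1 / (2 * C)) powr (p - 1) / 2 * measure M E powr p)
    \<le> (\<integral>\<^sup>+x\<in>E. ennreal (q x powr (p - 1)) \<partial>M)"
proof (cases "measure M E = 0")
  case False
  define m where "m = measure M E"
  have m_pos: "m > 0" using False by (simp add: m_def zero_less_measure_iff)
  define \<epsilon> where "\<epsilon> = m / (2 * C)"
  have \<epsilon>_pos: "\<epsilon> > 0" and C_\<epsilon>: "C * \<epsilon> = m / 2" using m_pos C_pos by (simp_all add: \<epsilon>_def)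
  define F where "F = {x \<in> E. \<epsilon> \<le> q x}"
  have [measurable]: "F \<in> sets M" unfolding F_def by measurable
  have "m \<le> measure M (F \<union> {x \<in> space M. q x < \<epsilon>})"
    unfolding m_def using sets.sets_into_space[OF E_sets] by (intro finite_measure_mono) (auto simp: F_def)
  also have "\<dots> \<le> measure M F + measure M {x \<in> space M. q x < \<epsilon>}"
    by (rule measure_Un_le) auto
  finally have half: "m / 2 \<le> measure M F" using sublevel[OF \<epsilon>_pos] C_\<epsilon> by linarith
  have "(1 / (2 * C)) powr (p - 1) / 2 * m powr p = \<epsilon> powr (p - 1) * (m / 2)"
  proof -
    have "m powr p = m powr (p - 1) * m" using m_pos by (simp add: powr_diff)
    then show ?thesis using m_pos C_pos by (simp add: \<epsilon>_def powr_divide)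
  qed
  also have "\<dots> \<le> \<epsilon> powr (p - 1) * measure M F"
    using half by (intro mult_left_mono) auto
  finally have "ennreal ((1 / (2 * C)) powr (p - 1) / 2 * m powr p) \<le> (\<integral>\<^sup>+x\<in>F. ennreal (\<epsilon> powr (p - 1)) \<partial>M)"
    by (simp add: nn_integral_cmult emeasure_eq_measure ennreal_mult[symmetric] ennreal_leI)
  also have "\<dots> \<le> (\<integral>\<^sup>+x\<in>E. ennreal (q x powr (p - 1)) \<partial>M)"
    using \<epsilon>_pos p_ge_1
    by (intro nn_integral_mono) (auto simp: F_def intro!: ennreal_leI powr_mono2 split: split_indicator)
  finally show ?thesis by (simp add: m_def)
qed simp

lemma slice_density_mult_weight_powr_le:
  assumes t: "0 < t" "t < 1" and "a \<le> p - 1"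
  shows "(1 - t\<^sup>2) powr (k / 2 - 1) * slice_weight k t powr (p - 1) \<le> t powr a * (1 - t\<^sup>2) powr (p * k / 2 - 1)"
proof -
  have "(1 - t\<^sup>2) powr (k / 2 - 1) * slice_weight k t powr (p - 1)
      = t powr (p - 1) * ((1 - t\<^sup>2) powr (k / 2 - 1) * (1 - t\<^sup>2) powr (k / 2 * (p - 1)))"
    using t one_minus_square_bounds[of t] by (simp add: slice_weight_def powr_mult powr_powr mult_ac)
  also have "\<dots> = t powr (p - 1) * (1 - t\<^sup>2) powr (p * k / 2 - 1)"
  proof -
    have "k / 2 - 1 + k / 2 * (p - 1) = p * k / 2 - 1" by (simp add: field_simps)
    then show ?thesis by (simp only: powr_add[symmetric])
  qed
  also have "\<dots> \<le> t powr a * (1 - t\<^sup>2) powr (p * k / 2 - 1)"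
    using assms by (intro mult_right_mono powr_mono') auto
  finally show ?thesis .
qed

lemma slice_measure_restricted_type:
  fixes k p a :: real
  assumes k_pos: "k > 0" and p_ge: "p \<ge> 1" "p \<ge> 1 + a"
  obtains c where "c > 0"
    and "\<And>E. E \<in> sets borel \<Longrightarrow>
      ennreal (c * measure (slice_measure 0 k) E powr p) \<le> emeasure (slice_measure a (p * k)) E"
proof -
  interpret finite_measure "slice_measure 0 k" using k_pos by (rule finite_slice_measure)
  obtain C where C_pos: "C > 0"
    and sublevel: "\<And>\<epsilon>. \<epsilon> > 0 \<Longrightarrow> emeasure (slice_measure 0 k) {u. slice_weight k u < \<epsilon>} \<le> ennreal (C * \<epsilon>)"
    using emeasure_slice_sublevel[OF k_pos] by metis
  show ?thesis
  proof
    show "(1 / (2 * C)) powr (p - 1) / 2 > 0" using C_pos by simp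
    fix E :: "real set" assume E_borel [measurable]: "E \<in> sets borel"
    have "ennreal ((1 / (2 * C)) powr (p - 1) / 2 * measure (slice_measure 0 k) E powr p)
        \<le> (\<integral>\<^sup>+t\<in>E. ennreal (slice_weight k t powr (p - 1)) \<partial>slice_measure 0 k)"
      using C_pos p_ge sublevel by (intro nn_integral_powr_ge_of_sublevel) (auto simp: emeasure_eq_measure)
    also have "\<dots> = (\<integral>\<^sup>+t. ennreal (t powr 0 * (1 - t\<^sup>2) powr (k / 2 - 1)) *
        (ennreal (slice_weight k t powr (p - 1)) * indicator E t) * indicator {0<..<1} t \<partial>lborel)"
      by (rule nn_integral_slice_measure) measurable
    also have "\<dots>
        \<le> (\<integral>\<^sup>+t. ennreal (t powr a * (1 - t\<^sup>2) powr (p * k / 2 - 1)) *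
          indicator E t * indicator {0<..<1} t \<partial>lborel)"
      using slice_density_mult_weight_powr_le[of _ a p k] p_ge
      by (intro nn_integral_mono)
         (auto simp: ennreal_mult[symmetric] intro!: ennreal_leI split: split_indicator)
    also have "\<dots> = emeasure (slice_measure a (p * k)) E"
      by (rule emeasure_slice_measure[OF E_borel, symmetric])
    finally show "ennreal ((1 / (2 * C)) powr (p - 1) / 2 * measure (slice_measure 0 k) E powr p)
      \<le> emeasure (slice_measure a (p * k)) E" .
  qed
qed

lemma slice_measure_dilation:
  fixes a b c :: real
  assumes c_bounds: "0 < c" "c \<le> 1" and "b \<ge> 2" and [measurable]: "E \<in> sets borel"
  shows "ennreal (c powr (1 + a)) * emeasure (slice_measure a b) {t. c * t \<in> E}
      \<le> emeasure (slice_measure a b) E"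
proof -
  let ?w = "\<lambda>t. t powr a * (1 - t\<^sup>2) powr (b / 2 - 1)"
  have density_le: "c powr a * ?w t \<le> ?w (c * t)" and dilated_less_1: "c * t < 1" if t: "0 < t" "t < 1" for t
  proof -
    have dilated_le: "c * t \<le> t" using t c_bounds by (simp add: mult_left_le_one_le)
    then show "c * t < 1" using t by linarith
    have "(c * t)\<^sup>2 \<le> t\<^sup>2" using dilated_le t c_bounds by (intro power_mono) auto
    then have "(1 - t\<^sup>2) powr (b / 2 - 1) \<le> (1 - (c * t)\<^sup>2) powr (b / 2 - 1)"
      using one_minus_square_bounds[of t] t \<open>b \<ge> 2\<close> by (intro powr_mono2) auto
    then show "c powr a * ?w t \<le> ?w (c * t)"
      using t c_bounds by (simp add: powr_mult mult_left_mono)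
  qed
  have "ennreal (c powr (1 + a)) * emeasure (slice_measure a b) {t. c * t \<in> E}
      = ennreal c *
        (\<integral>\<^sup>+t. ennreal (c powr a) * (ennreal (?w t) * indicator {t. c * t \<in> E} t * indicator {0<..<1} t) \<partial>lborel)"
    using c_bounds
    by (subst emeasure_slice_measure) (auto simp: nn_integral_cmult powr_add ennreal_mult mult.assoc)
  also have "\<dots>
      \<le> ennreal c *
        (\<integral>\<^sup>+t. ennreal (?w (0 + c * t)) * indicator E (0 + c * t) * indicator {0<..<1} (0 + c * t) \<partial>lborel)"
    using c_bounds density_le dilated_less_1
    by (intro mult_left_mono nn_integral_mono)
       (auto simp: ennreal_mult[symmetric] intro!: ennreal_leI split: split_indicator)
  also have "\<dots> = emeasure (slice_measure a b) E"
    using c_bounds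
    by (subst emeasure_slice_measure, simp, subst nn_integral_real_affine[where c = c and t = 0]) auto
  finally show ?thesis .
qed

lemma slice_measure_dilated_restricted_type:
  fixes k p a :: real
  assumes k_pos: "k > 0" and p_ge: "p \<ge> 1" "p \<ge> 1 + a" and pk_ge: "p * k \<ge> 2"
  obtains c0 where "c0 > 0"
    and "\<And>c E. \<lbrakk>0 < c; c \<le> 1; E \<in> sets borel\<rbrakk> \<Longrightarrow>
      ennreal (c0 * c powr ((1 + a) / p)) * emeasure (slice_measure 0 k) {t. c * t \<in> E}
        \<le> enn_powr (emeasure (slice_measure a (p * k)) E) (1 / p)"
proof -
  let ?L = "slice_measure 0 k" and ?N = "slice_measure a (p * k)"
  interpret finite_measure ?L using k_pos by (rule finite_slice_measure)
  obtain c1 where c1_pos: "c1 > 0"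
    and restricted_type: "\<And>E. E \<in> sets borel \<Longrightarrow> ennreal (c1 * measure ?L E powr p) \<le> emeasure ?N E"
    using slice_measure_restricted_type[OF k_pos p_ge] by metis
  show ?thesis
  proof
    show "c1 powr (1 / p) > 0" using c1_pos by simp
    fix c :: real and E :: "real set"
    assume c_bounds: "0 < c" "c \<le> 1" and [measurable]: "E \<in> sets borel"
    define m where "m = measure ?L {t. c * t \<in> E}"
    have "ennreal (c1 * c powr (1 + a) * m powr p) = ennreal (c powr (1 + a)) * ennreal (c1 * m powr p)"
      using c1_pos by (simp add: ennreal_mult[symmetric] mult_ac)
    also have "\<dots> \<le> ennreal (c powr (1 + a)) * emeasure ?N {t. c * t \<in> E}"
      unfolding m_def by (intro mult_left_mono restricted_type) auto
    also have "\<dots> \<le> emeasure ?N E"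
      using c_bounds pk_ge by (intro slice_measure_dilation) auto
    finally have "enn_powr (ennreal (c1 * c powr (1 + a) * m powr p)) (1 / p)
        \<le> enn_powr (emeasure ?N E) (1 / p)"
      using p_ge by (intro enn_powr_mono) auto
    moreover have "(c1 * c powr (1 + a) * m powr p) powr (1 / p) = c1 powr (1 / p) * c powr ((1 + a) / p) * m"
      using p_ge c1_pos by (simp add: m_def powr_mult powr_powr)
    ultimately show "ennreal (c1 powr (1 / p) * c powr ((1 + a) / p)) * emeasure ?L {t. c * t \<in> E}
        \<le> enn_powr (emeasure ?N E) (1 / p)"
      using c1_pos by (simp add: enn_powr_ennreal emeasure_eq_measure m_def ennreal_mult[symmetric])
  qed
qed

lemma slice_lorentz_estimate:
  fixes k p a :: real
  assumes k_pos: "k > 0" and p_ge: "p \<ge> 1" "p \<ge> 1 + a" and pk_ge: "p * k \<ge> 2"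
  obtains C where "C \<ge> 0"
    and "\<And>c F. \<lbrakk>0 < c; c \<le> 1; F \<in> borel_measurable borel\<rbrakk> \<Longrightarrow>
      ennreal (c powr ((1 + a) / p)) * (\<integral>\<^sup>+t. ennreal \<bar>F (c * t)\<bar> \<partial>slice_measure 0 k)
        \<le> ennreal C * lorentz_norm (slice_measure a (p * k)) p F"
proof -
  let ?L = "slice_measure 0 k" and ?N = "slice_measure a (p * k)"
  interpret finite_measure ?L using k_pos by (rule finite_slice_measure)
  obtain c0 where c0_pos: "c0 > 0"
    and restricted_type: "\<And>c E. \<lbrakk>0 < c; c \<le> 1; E \<in> sets borel\<rbrakk> \<Longrightarrow>
      ennreal (c0 * c powr ((1 + a) / p)) * emeasure ?L {t. c * t \<in> E} \<le> enn_powr (emeasure ?N E) (1 / p)"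
    using slice_measure_dilated_restricted_type[OF k_pos p_ge pk_ge] by metis
  show ?thesis
  proof
    show "1 / (p * c0) \<ge> 0" using p_ge c0_pos by simp
    fix c :: real and F :: "real \<Rightarrow> real"
    assume c_bounds: "0 < c" "c \<le> 1" and [measurable]: "F \<in> borel_measurable borel"
    let ?X = "\<integral>\<^sup>+t. ennreal \<bar>F (c * t)\<bar> \<partial>?L" and ?b = "c0 * c powr ((1 + a) / p)"
    have "ennreal p * (ennreal ?b * (\<integral>\<^sup>+t. ennreal \<bar>F t\<bar> \<partial>distr ?L borel (\<lambda>t. c * t))) \<le> lorentz_norm ?N p F"
      using p_ge restricted_type[OF c_bounds]
      by (intro nn_integral_le_lorentz_norm finite_measure.axioms(1) finite_measure_distr)
         (auto simp: emeasure_distr vimage_def)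
    then have "ennreal (1 / (p * c0)) * (ennreal p * (ennreal ?b * ?X))
        \<le> ennreal (1 / (p * c0)) * lorentz_norm ?N p F"
      by (intro mult_left_mono) (simp_all add: nn_integral_distr)
    moreover have "ennreal (1 / (p * c0)) * (ennreal p * ennreal ?b) = ennreal (c powr ((1 + a) / p))"
      using p_ge c0_pos by (simp add: ennreal_mult[symmetric])
    ultimately show "ennreal (c powr ((1 + a) / p)) * ?X \<le> ennreal (1 / (p * c0)) * lorentz_norm ?N p F"
      by (simp add: mult.assoc[symmetric])
  qed
qed

section \<open>Even radial functions and great subspheres\<close>

lemma cos_sin_sdist:
  fixes e x :: "'a::euclidean_space"
  assumes "norm e = 1" "x \<in> sphere 0 1"
  shows "cos (sdist e x) = x \<bullet> e" "sin (sdist e x) = sqrt (1 - (x \<bullet> e)\<^sup>2)"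
proof -
  have "\<bar>e \<bullet> x\<bar> \<le> 1" using Cauchy_Schwarz_ineq2[of e x] assms by simp
  then show "cos (sdist e x) = x \<bullet> e" "sin (sdist e x) = sqrt (1 - (x \<bullet> e)\<^sup>2)"
    by (auto simp: sdist_def sin_arccos abs_le_iff inner_commute)
qed

lemma space_weighted_sphere_measure [simp]: "space (weighted_sphere_measure e a1 a2) = sphere 0 1"
  by (simp add: weighted_sphere_measure_def)

lemma nn_integral_slice_measure_reweight:
  assumes [measurable]: "G \<in> borel_measurable borel"
  shows "(\<integral>\<^sup>+t. ennreal (sqrt (1 - t\<^sup>2) powr a1 * t powr a2) * G t \<partial>slice_measure 0 k) =
    (\<integral>\<^sup>+t. G t \<partial>slice_measure a2 (a1 + k))"
proof (subst (1 2) nn_integral_slice_measure, measurable, rule nn_integral_cong)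
  fix t :: real
  have "(1 - t\<^sup>2) powr (k / 2 - 1) * (sqrt (1 - t\<^sup>2) powr a1 * t powr a2)
      = t powr a2 * (1 - t\<^sup>2) powr ((a1 + k) / 2 - 1)" if "0 < t" "t < 1"
  proof -
    have "sqrt (1 - t\<^sup>2) powr a1 = (1 - t\<^sup>2) powr (a1 / 2)"
      using one_minus_square_bounds[of t] that by (simp add: powr_half_sqrt[symmetric] powr_powr)
    moreover have "(1 - t\<^sup>2) powr (k / 2 - 1) * (1 - t\<^sup>2) powr (a1 / 2) = (1 - t\<^sup>2) powr ((a1 + k) / 2 - 1)"
      unfolding powr_add[symmetric] by (rule arg_cong[where f = "(powr) _"]) (simp add: field_simps)
    ultimately show ?thesis by (simp add: mult_ac)
  qed
  then show "ennreal (t powr 0 * (1 - t\<^sup>2) powr (k / 2 - 1)) *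
      (ennreal (sqrt (1 - t\<^sup>2) powr a1 * t powr a2) * G t) * indicator {0<..<1} t
    = ennreal (t powr a2 * (1 - t\<^sup>2) powr ((a1 + k) / 2 - 1)) * G t * indicator {0<..<1} t"
    by (simp add: mult.assoc[symmetric] ennreal_mult[symmetric] split: split_indicator) (simp add: mult.commute)
qed

lemma emeasure_weighted_sphere_slice:
  fixes e :: "real^'n"
  assumes norm_e: "norm e = 1" and dim_ge_2: "CARD('n) \<ge> 2" and [measurable]: "E \<in> sets borel"
  shows "emeasure (weighted_sphere_measure e a1 a2) {x \<in> sphere 0 1. \<bar>x \<bullet> e\<bar> \<in> E} =
    ennreal (slice_const CARD('n)) * emeasure (slice_measure a2 (a1 + real CARD('n) - 1)) E"
proof -
  define w where "w t = ennreal (sqrt (1 - t\<^sup>2) powr a1 * t powr a2)" for t :: real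
  have [measurable]: "w \<in> borel_measurable borel" unfolding w_def by measurable
  let ?W = "\<lambda>x. ennreal (sin (sdist e x) powr a1 * \<bar>cos (sdist e x)\<bar> powr a2)"
  have weight: "?W x = w \<bar>x \<bullet> e\<bar>" if "x \<in> sphere 0 1" for x
    unfolding w_def using cos_sin_sdist[OF norm_e that] by simp
  have "(\<lambda>x. w \<bar>x \<bullet> e\<bar>) \<in> borel_measurable sphere_measure" by measurable
  then have weight_meas: "?W \<in> borel_measurable sphere_measure"
    using weight by (subst measurable_cong[where g = "\<lambda>x. w \<bar>x \<bullet> e\<bar>"]) auto
  have "{x. \<bar>x \<bullet> e\<bar> \<in> E} \<in> sets borel" by measurable
  then have "{x \<in> sphere 0 1. \<bar>x \<bullet> e\<bar> \<in> E} \<in> sets sphere_measure"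
    unfolding sets_sphere_measure sets_restrict_space by auto
  with weight_meas have "emeasure (weighted_sphere_measure e a1 a2) {x \<in> sphere 0 1. \<bar>x \<bullet> e\<bar> \<in> E}
      = (\<integral>\<^sup>+x. ?W x * indicator {x \<in> sphere 0 1. \<bar>x \<bullet> e\<bar> \<in> E} x \<partial>sphere_measure)"
    unfolding weighted_sphere_measure_def by (rule emeasure_density)
  also have "\<dots> = (\<integral>\<^sup>+x. w \<bar>x \<bullet> e\<bar> * indicator E \<bar>x \<bullet> e\<bar> \<partial>sphere_measure)"
    using weight by (intro nn_integral_cong) (auto simp: indicator_def)
  also have "\<dots>
      = ennreal (slice_const CARD('n)) * (\<integral>\<^sup>+t. w t * indicator E t \<partial>slice_measure 0 (real CARD('n) - 1))"
    using nn_integral_sphere_slice[OF dim_ge_2, of "\<lambda>t. w t * indicator E t" e] by (simp add: norm_e)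
  also have "(\<integral>\<^sup>+t. w t * indicator E t \<partial>slice_measure 0 (real CARD('n) - 1))
      = emeasure (slice_measure a2 (a1 + real CARD('n) - 1)) E"
    unfolding w_def by (subst nn_integral_slice_measure_reweight) (simp_all add: add_diff_eq)
  finally show ?thesis .
qed

lemma lorentz_norm_weighted_sphere:
  fixes e :: "real^'n" and f :: "real^'n \<Rightarrow> real"
  assumes norm_e: "norm e = 1" and dim_ge_2: "CARD('n) \<ge> 2" and p_pos: "0 < p"
    and [measurable]: "F \<in> borel_measurable borel" and profile: "\<And>x. x \<in> sphere 0 1 \<Longrightarrow> f x = F \<bar>x \<bullet> e\<bar>"
  shows "lorentz_norm (weighted_sphere_measure e a1 a2) p f =
    ennreal (slice_const CARD('n) powr (1 / p)) * lorentz_norm (slice_measure a2 (a1 + real CARD('n) - 1)) p F"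
proof (rule lorentz_norm_scaled_distribution[OF p_pos slice_const_pos[OF dim_ge_2]])
  fix s :: real
  have "{x \<in> sphere 0 1. s < \<bar>f x\<bar>} = {x \<in> sphere 0 1. \<bar>x \<bullet> e\<bar> \<in> {t. s < \<bar>F t\<bar>}}"
    using profile by auto
  then show "emeasure (weighted_sphere_measure e a1 a2) {x \<in> space (weighted_sphere_measure e a1 a2). s < \<bar>f x\<bar>}
      = ennreal (slice_const CARD('n)) * emeasure (slice_measure a2 (a1 + real CARD('n) - 1))
          {t \<in> space (slice_measure a2 (a1 + real CARD('n) - 1)). s < \<bar>F t\<bar>}"
    using emeasure_weighted_sphere_slice[OF norm_e dim_ge_2, of "{t. s < \<bar>F t\<bar>}" a1 a2] by simp
qed simp

text \<open>The profile is measurable because it is the composition of f with a meridian through e.\<close>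
lemma even_radial_profile:
  fixes f :: "'a::euclidean_space \<Rightarrow> real"
  assumes norm_e: "norm e = 1" and dim_ge_2: "DIM('a) \<ge> 2"
    and f_meas: "f \<in> borel_measurable sphere_measure" and even_radial: "even_radial e f"
  obtains F where "F \<in> borel_measurable borel" and "\<And>x. x \<in> sphere 0 1 \<Longrightarrow> f x = F \<bar>x \<bullet> e\<bar>"
proof -
  obtain F0 where profile: "\<And>x. x \<in> sphere 0 1 \<Longrightarrow> f x = F0 \<bar>x \<bullet> e\<bar>"
    using even_radial by (auto simp: even_radial_def)
  obtain z where z: "z \<noteq> 0" "orthogonal e z"
    using orthogonal_to_vector_exists[of e] dim_ge_2 by auto
  define e' where "e' = z /\<^sub>R norm z"
  have orthonormal: "e' \<bullet> e' = 1" "e \<bullet> e' = 0" "e' \<bullet> e = 0" "e \<bullet> e = 1"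
    using z norm_e by (auto simp: e'_def orthogonal_def inner_commute dot_square_norm power2_eq_square)
  define r where "r t = max 0 (min 1 t)" for t :: real
  define x where "x t = r t *\<^sub>R e + sqrt (1 - (r t)\<^sup>2) *\<^sub>R e'" for t
  have r_bounds: "0 \<le> r t" "r t \<le> 1" for t by (auto simp: r_def)
  have "x t \<bullet> x t = (r t)\<^sup>2 + (sqrt (1 - (r t)\<^sup>2))\<^sup>2" for t
    using orthonormal by (simp add: x_def inner_add_left inner_add_right power2_eq_square)
  then have "x t \<bullet> x t = 1" for t using r_bounds[of t] by (simp add: power_le_one)
  then have x_sphere: "x t \<in> sphere 0 1" for t by (simp add: norm_eq_sqrt_inner)
  have x_inner: "x t \<bullet> e = r t" for t
    using orthonormal by (simp add: x_def inner_add_left)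
  have "x \<in> borel_measurable borel" unfolding x_def r_def by measurable
  then have "x \<in> measurable borel sphere_measure"
    using x_sphere
    by (subst measurable_cong_sets[OF refl sets_sphere_measure]) (intro measurable_restrict_space2, auto)
  then have "(\<lambda>t. f (x t)) \<in> borel_measurable borel"
    using f_meas by (rule measurable_compose)
  moreover have "f y = f (x \<bar>y \<bullet> e\<bar>)" if "y \<in> sphere 0 1" for y
  proof -
    have "\<bar>y \<bullet> e\<bar> \<le> 1" using Cauchy_Schwarz_ineq2[of y e] that norm_e by simp
    then have "r \<bar>y \<bullet> e\<bar> = \<bar>y \<bullet> e\<bar>" by (simp add: r_def)
    then show ?thesis using profile[OF that] profile[OF x_sphere, of "\<bar>y \<bullet> e\<bar>"] by (simp add: x_inner)
  qed
  ultimately show ?thesis by (rule that)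
qed

lemma param_iso_isometry:
  fixes V :: "(real^'j) set"
  assumes V: "subspace V" "dim V = CARD('k)"
  defines "T \<equiv> param_iso V :: real^'k \<Rightarrow> real^'j"
  shows "linear T" "norm (T y) = norm y" "range T = V"
proof -
  have "dim (UNIV :: (real^'k) set) = dim V" using V(2) by simp
  then obtain f :: "real^'k \<Rightarrow> real^'j" where "linear f" "f ` UNIV = V" "\<And>x. norm (f x) = norm x"
    using isometries_subspaces[OF subspace_UNIV V(1)] by (metis UNIV_I)
  then have "\<exists>T :: real^'k \<Rightarrow> real^'j. linear T \<and> (\<forall>y. norm (T y) = norm y) \<and> range T = V"
    by blast
  from someI_ex[OF this] show "linear T" "norm (T y) = norm y" "range T = V"
    unfolding T_def param_iso_def by blast+
qed

lemma subspace_range_matrix: "subspace (range (\<lambda>y. A *v y))" for A :: "real^'k^'j"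
  by (intro linear_subspace_image) auto

lemma dim_range_matrix:
  fixes A :: "real^'k^'j"
  assumes "inj (\<lambda>y. A *v y)"
  shows "dim (range (\<lambda>y. A *v y)) = CARD('k)"
  using assms dim_image_eq[of "\<lambda>y. A *v y" "UNIV :: (real^'k) set"] by simp

lemma sdist_set_range_isometry:
  fixes T :: "real^'k \<Rightarrow> 'a::euclidean_space"
  assumes norm_T: "\<And>y. norm (T y) = norm y" and pole: "\<And>y. T y \<bullet> e = y \<bullet> w" and norm_w_le: "norm w \<le> 1"
  shows "sdist_set e (range T \<inter> sphere 0 1) = arccos (norm w)"
proof -
  have image_eq: "sdist e ` (range T \<inter> sphere 0 1) = (\<lambda>y. arccos (y \<bullet> w)) ` sphere 0 1"
    by (force simp: sdist_def pole[symmetric] inner_commute norm_T image_iff)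
  show ?thesis unfolding sdist_set_def image_eq
  proof (rule cInf_eq_minimum)
    show "arccos (norm w) \<in> (\<lambda>y. arccos (y \<bullet> w)) ` sphere 0 1"
    proof (cases "w = 0")
      case True
      then show ?thesis by (auto intro!: image_eqI[of _ _ "axis undefined 1"])
    next
      case False
      then have "(w /\<^sub>R norm w) \<bullet> w = norm w" by (simp add: dot_square_norm power2_eq_square)
      then show ?thesis using False by (auto intro!: image_eqI[of _ _ "w /\<^sub>R norm w"])
    qed
    fix z assume "z \<in> (\<lambda>y. arccos (y \<bullet> w)) ` sphere 0 1"
    then obtain y where y: "norm y = 1" "z = arccos (y \<bullet> w)" by auto
    then have "\<bar>y \<bullet> w\<bar> \<le> norm w" using Cauchy_Schwarz_ineq2[of y w] by simp
    then show "arccos (norm w) \<le> z"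
      using y norm_w_le by (auto intro!: arccos_le_arccos)
  qed
qed

abbreviation plane_cos :: "real^'j \<Rightarrow> (real^'j) set \<Rightarrow> real" where
  "plane_cos e V \<equiv> cos (sdist_set e (V \<inter> sphere 0 1))"

text \<open>The vector w is the orthogonal projection of e to V, pulled back to the parameter space.\<close>
lemma param_iso_pole:
  fixes V :: "(real^'j) set" and e :: "real^'j"
  assumes V: "subspace V" "dim V = CARD('k)" and norm_e: "norm e = 1"
  obtains w :: "real^'k" where "\<And>y. param_iso V y \<bullet> e = y \<bullet> w" "norm w \<le> 1"
    "sdist_set e (V \<inter> sphere 0 1) = arccos (norm w)" "plane_cos e V = norm w"
proof
  let ?T = "param_iso V :: real^'k \<Rightarrow> real^'j"
  note T = param_iso_isometry[OF V]
  define w where "w = adjoint ?T e"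
  show pole: "?T y \<bullet> e = y \<bullet> w" for y
    using adjoint_works[OF T(1)] by (simp add: w_def)
  have "norm w * norm w = ?T w \<bullet> e" by (simp add: pole dot_square_norm power2_eq_square)
  also have "\<dots> \<le> norm w" using Cauchy_Schwarz_ineq2[of "?T w" e] T(2) norm_e by simp
  finally show norm_w_le: "norm w \<le> 1" by (cases "w = 0") auto
  show sdist_eq: "sdist_set e (V \<inter> sphere 0 1) = arccos (norm w)"
    using sdist_set_range_isometry[OF T(2) pole norm_w_le] by (simp add: T(3))
  show "plane_cos e V = norm w"
    unfolding sdist_eq using norm_w_le by (simp add: cos_arccos order_trans[OF _ norm_ge_zero])
qed

lemma sdist_set_less_pi_half_iff:
  fixes V :: "(real^'j) set" and e :: "real^'j"
  assumes "subspace V" "dim V = CARD('k::finite)" "norm e = 1"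
  shows "sdist_set e (V \<inter> sphere 0 1) < pi / 2 \<longleftrightarrow> 0 < plane_cos e V"
proof -
  obtain w :: "real^'k" where "norm w \<le> 1"
    "sdist_set e (V \<inter> sphere 0 1) = arccos (norm w)" "plane_cos e V = norm w"
    using param_iso_pole[OF assms] by metis
  then show ?thesis
    using arccos_less_arccos[of 0 "norm w"] by (cases "w = 0") auto
qed

lemma AE_planesI:
  fixes e :: "real^'j"
  assumes norm_e: "norm e = 1"
    and planes: "\<And>V. \<lbrakk>subspace V; dim V = CARD('k::finite); 0 < plane_cos e V\<rbrakk> \<Longrightarrow> P V"
  shows "AE_planes TYPE('k) e P"
  unfolding AE_planes_def
proof (intro AE_I2 impI)
  fix A :: "real^'k^'j"
  assume plane: "inj (\<lambda>y. A *v y) \<and> sdist_set e (range (\<lambda>y. A *v y) \<inter> sphere 0 1) < pi / 2"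
  then have "dim (range (\<lambda>y. A *v y)) = CARD('k)" by (simp add: dim_range_matrix)
  with plane show "P (range (\<lambda>y. A *v y))"
    using sdist_set_less_pi_half_iff[OF subspace_range_matrix _ norm_e]
    by (intro planes subspace_range_matrix) auto
qed

lemma nn_integral_param_iso:
  fixes V :: "(real^'j) set" and e :: "real^'j"
  assumes V: "subspace V" "dim V = CARD('k)" and norm_e: "norm e = 1" and card_k: "CARD('k::finite) \<ge> 2"
    and G_meas: "G \<in> borel_measurable borel"
  shows "(\<integral>\<^sup>+y. G \<bar>param_iso V y \<bullet> e\<bar> \<partial>(sphere_measure :: (real^'k) measure)) =
    ennreal (slice_const CARD('k)) * (\<integral>\<^sup>+t. G (plane_cos e V * t) \<partial>slice_measure 0 (real CARD('k) - 1))"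
proof -
  obtain w :: "real^'k" where "\<And>y. param_iso V y \<bullet> e = y \<bullet> w" "plane_cos e V = norm w"
    using param_iso_pole[OF V norm_e] by metis
  then show ?thesis using nn_integral_sphere_slice[OF card_k G_meas, of w] by simp
qed

lemma radon_bound:
  fixes V :: "(real^'j) set" and e :: "real^'j"
  assumes V: "subspace V" "dim V = CARD('k)" and norm_e: "norm e = 1" and card_k: "CARD('k::finite) \<ge> 2"
    and [measurable]: "F \<in> borel_measurable borel" and profile: "\<And>x. x \<in> sphere 0 1 \<Longrightarrow> f x = F \<bar>x \<bullet> e\<bar>"
  defines "I \<equiv> \<integral>\<^sup>+t. ennreal \<bar>F (plane_cos e V * t)\<bar> \<partial>slice_measure 0 (real CARD('k) - 1)"
  assumes finite: "I < \<infinity>"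
  shows "radon_integrable TYPE('k) f V"
    and "ennreal \<bar>radon TYPE('k) f V\<bar> \<le> ennreal (slice_const CARD('k)) * I"
proof -
  let ?S = "sphere_measure :: (real^'k) measure"
  let ?T = "param_iso V :: real^'k \<Rightarrow> real^'j"
  note T = param_iso_isometry[OF V]
  have [measurable]: "?T \<in> borel_measurable borel"
    using T(1) by (rule borel_measurable_linear)
  have profile_T: "f (?T y) = F \<bar>?T y \<bullet> e\<bar>" if "y \<in> space ?S" for y
    using profile[of "?T y"] that T(2) by simp
  have "(\<lambda>y. F \<bar>?T y \<bullet> e\<bar>) \<in> borel_measurable ?S" by measurable
  then have meas: "(\<lambda>y. f (?T y)) \<in> borel_measurable ?S"
    using profile_T by (subst measurable_cong) auto
  have "(\<integral>\<^sup>+y. ennreal (norm (f (?T y))) \<partial>?S) = (\<integral>\<^sup>+y. ennreal \<bar>F \<bar>?T y \<bullet> e\<bar>\<bar> \<partial>?S)"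
    using profile_T by (intro nn_integral_cong) simp
  also have "\<dots> = ennreal (slice_const CARD('k)) * I"
    unfolding I_def by (rule nn_integral_param_iso[OF V norm_e card_k]) measurable
  finally have nn_integral_norm: "(\<integral>\<^sup>+y. ennreal (norm (f (?T y))) \<partial>?S) = ennreal (slice_const CARD('k)) * I" .
  then have integrable: "integrable ?S (\<lambda>y. f (?T y))"
    using finite by (intro integrableI_bounded meas) (simp add: ennreal_mult_less_top)
  then show "radon_integrable TYPE('k) f V" by (simp add: radon_integrable_def)
  show "ennreal \<bar>radon TYPE('k) f V\<bar> \<le> ennreal (slice_const CARD('k)) * I"
    using integral_norm_bound_ennreal[OF integrable] by (simp add: radon_def nn_integral_norm[symmetric])
qed

lemma radon_weighted_bound:
  fixes V :: "(real^'j) set" and e :: "real^'j"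
  assumes V: "subspace V" "dim V = CARD('k)" and norm_e: "norm e = 1" and card_k: "CARD('k::finite) \<ge> 2"
    and F_meas: "F \<in> borel_measurable borel" and profile: "\<And>x. x \<in> sphere 0 1 \<Longrightarrow> f x = F \<bar>x \<bullet> e\<bar>"
    and cos_pos: "0 < plane_cos e V" and \<beta>_le: "\<beta> \<le> \<gamma>"
    and slice_bound: "ennreal (plane_cos e V powr \<beta>) *
      (\<integral>\<^sup>+t. ennreal \<bar>F (plane_cos e V * t)\<bar> \<partial>slice_measure 0 (real CARD('k) - 1)) \<le> B" and "B < \<infinity>"
  shows "radon_integrable TYPE('k) f V"
    and "ennreal \<bar>plane_cos e V powr \<gamma> * radon TYPE('k) f V\<bar> \<le> ennreal (slice_const CARD('k)) * B"
proof -
  let ?c = "plane_cos e V" and ?K = "ennreal (slice_const CARD('k))"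
  let ?I = "\<integral>\<^sup>+t. ennreal \<bar>F (?c * t)\<bar> \<partial>slice_measure 0 (real CARD('k) - 1)"
  have "?I < \<infinity>"
    using le_less_trans[OF slice_bound \<open>B < \<infinity>\<close>] cos_pos by (auto simp: ennreal_mult_less_top)
  note radon = radon_bound[OF V norm_e card_k F_meas profile this]
  show "radon_integrable TYPE('k) f V" by (rule radon(1))
  have "ennreal \<bar>?c powr \<gamma> * radon TYPE('k) f V\<bar> \<le> ennreal (?c powr \<beta>) * (?K * ?I)"
    unfolding abs_mult using cos_pos \<beta>_le radon(2)
    by (subst ennreal_mult) (auto intro!: mult_mono ennreal_leI powr_mono')
  also have "\<dots> \<le> ?K * B"
    using slice_bound by (subst mult.left_commute) (rule mult_left_mono, auto)
  finally show "ennreal \<bar>?c powr \<gamma> * radon TYPE('k) f V\<bar> \<le> ?K * B" .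
qed

lemma radon_estimate_sufficient:
  fixes e :: "real^'j"
  assumes norm_e: "norm e = 1" and card_j: "CARD('j) \<ge> 2" and card_k: "CARD('k::finite) \<ge> 2"
    and exponent: "a1 + real CARD('j) - 1 = p * (real CARD('k) - 1)"
    and p_ge: "p \<ge> 1" "p \<ge> 1 + a2" and pk_ge: "p * (real CARD('k) - 1) \<ge> 2" and \<gamma>_ge: "\<gamma> \<ge> (1 + a2) / p"
  shows "radon_estimate TYPE('k) e a1 a2 p \<gamma>"
proof -
  let ?k = "real CARD('k) - 1" and ?J = "slice_const CARD('j) powr (1 / p)" and ?K = "slice_const CARD('k)"
  have J_pos: "?J > 0" and K_pos: "?K > 0"
    using slice_const_pos[OF card_j] slice_const_pos[OF card_k] by simp_all
  have "?k > 0" using card_k by simp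
  then obtain C where C_nonneg: "C \<ge> 0"
    and slice_estimate: "\<And>c F. \<lbrakk>0 < c; c \<le> 1; F \<in> borel_measurable borel\<rbrakk> \<Longrightarrow>
      ennreal (c powr ((1 + a2) / p)) * (\<integral>\<^sup>+t. ennreal \<bar>F (c * t)\<bar> \<partial>slice_measure 0 ?k)
        \<le> ennreal C * lorentz_norm (slice_measure a2 (p * ?k)) p F"
    using slice_lorentz_estimate[OF _ p_ge pk_ge] by metis
  show ?thesis unfolding radon_estimate_def
  proof (intro exI[of _ "?K * C / ?J"] conjI allI impI)
    show "?K * C / ?J \<ge> 0" using K_pos C_nonneg J_pos by simp
    fix f :: "real^'j \<Rightarrow> real"
    let ?f_norm = "lorentz_norm (weighted_sphere_measure e a1 a2) p f"
    assume f: "f \<in> borel_measurable sphere_measure" "even_radial e f" and f_norm_finite: "?f_norm < \<infinity>"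
    have "DIM(real^'j) \<ge> 2" using card_j by simp
    from even_radial_profile[OF norm_e this f] obtain F where F_meas: "F \<in> borel_measurable borel"
      and profile: "\<And>x. x \<in> sphere 0 1 \<Longrightarrow> f x = F \<bar>x \<bullet> e\<bar>"
      by metis
    let ?F_norm = "lorentz_norm (slice_measure a2 (p * ?k)) p F"
    have f_norm: "?f_norm = ennreal ?J * ?F_norm"
      using lorentz_norm_weighted_sphere[OF norm_e card_j _ F_meas profile, of p a1 a2] p_ge(1)
      by (simp add: exponent)
    then have F_norm_finite: "ennreal C * ?F_norm < \<infinity>"
      using f_norm_finite J_pos by (auto simp: ennreal_mult_less_top)
    have constant_eq: "ennreal ?K * (ennreal C * ?F_norm) = ennreal (?K * C / ?J) * ?f_norm"
      using K_pos C_nonneg J_pos by (simp add: f_norm mult.assoc[symmetric] ennreal_mult[symmetric])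
    show "AE_planes TYPE('k) e (\<lambda>V. radon_integrable TYPE('k) f V \<and>
        ennreal \<bar>plane_cos e V powr \<gamma> * radon TYPE('k) f V\<bar> \<le> ennreal (?K * C / ?J) * ?f_norm)"
    proof (rule AE_planesI[OF norm_e])
      fix V :: "(real^'j) set"
      assume V: "subspace V" "dim V = CARD('k)" and cos_pos: "0 < plane_cos e V"
      then have "ennreal (plane_cos e V powr ((1 + a2) / p)) *
          (\<integral>\<^sup>+t. ennreal \<bar>F (plane_cos e V * t)\<bar> \<partial>slice_measure 0 ?k) \<le> ennreal C * ?F_norm"
        by (intro slice_estimate F_meas) auto
      from radon_weighted_bound[OF V norm_e card_k F_meas profile cos_pos \<gamma>_ge this F_norm_finite]
      show "radon_integrable TYPE('k) f V \<and>
          ennreal \<bar>plane_cos e V powr \<gamma> * radon TYPE('k) f V\<bar> \<le> ennreal (?K * C / ?J) * ?f_norm"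
        by (simp only: constant_eq)
    qed
  qed
qed

section \<open>Necessary conditions\<close>

lemma plane_cos_greater:
  fixes V :: "(real^'j) set" and e :: "real^'j"
  assumes V: "subspace V" "dim V = CARD('k::finite)" and norm_e: "norm e = 1"
    and x: "x \<in> V" "c * norm x < x \<bullet> e"
  shows "c < plane_cos e V"
proof -
  obtain w :: "real^'k" where pole: "\<And>y. param_iso V y \<bullet> e = y \<bullet> w" and cos_eq: "plane_cos e V = norm w"
    using param_iso_pole[OF V norm_e] by metis
  note T = param_iso_isometry[OF V]
  obtain y :: "real^'k" where x_eq: "x = param_iso V y" using x(1) T(3) by blast
  have "c * norm y < y \<bullet> w" using x(2) by (simp add: x_eq pole T(2))
  also have "\<dots> \<le> norm w * norm y" using norm_cauchy_schwarz[of y w] by (simp add: mult.commute)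
  finally show ?thesis by (simp add: cos_eq mult_less_cancel_right)
qed

lemma plane_cos_less:
  fixes V :: "(real^'j) set" and e :: "real^'j"
  assumes V: "subspace V" "dim V = CARD('k::finite)" and norm_e: "norm e = 1" and c_pos: "0 < c"
    and less: "\<And>x. x \<in> V \<Longrightarrow> x \<noteq> 0 \<Longrightarrow> x \<bullet> e < c * norm x"
  shows "plane_cos e V < c"
proof -
  obtain w :: "real^'k" where pole: "\<And>y. param_iso V y \<bullet> e = y \<bullet> w" and cos_eq: "plane_cos e V = norm w"
    using param_iso_pole[OF V norm_e] by metis
  note T = param_iso_isometry[OF V]
  show ?thesis
  proof (cases "w = 0")
    case False
    then have "param_iso V w \<noteq> 0" using T(2)[of w] by auto
    then have "w \<bullet> w < c * norm w" using less[of "param_iso V w"] T by (auto simp: pole)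
    then show ?thesis using False by (simp add: cos_eq dot_square_norm power2_eq_square)
  qed (use c_pos cos_eq in simp)
qed

definition matrices_cos_between :: "real^'j \<Rightarrow> real \<Rightarrow> real \<Rightarrow> (real^'k^'j) set" where
  "matrices_cos_between e c1 c2 =
    {A. (\<exists>y. c1 * norm (A *v y) < (A *v y) \<bullet> e) \<and> (\<forall>y\<in>sphere 0 1. (A *v y) \<bullet> e < c2 * norm (A *v y))}"

lemma open_matrices_cos_between: "open (matrices_cos_between e c1 c2 :: (real^'k^'j) set)"
proof -
  have "continuous_on UNIV (\<lambda>A :: real^'k^'j. A *v y)" for y
    unfolding matrix_vector_mult_def by (intro continuous_intros)
  then have "open {A :: real^'k^'j. c1 * norm (A *v y) < (A *v y) \<bullet> e}" for y
    by (intro open_Collect_less continuous_intros)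
  then have lower: "open (\<Union>y. {A :: real^'k^'j. c1 * norm (A *v y) < (A *v y) \<bullet> e})" by blast
  let ?Z = "{z :: (real^'k) \<times> (real^'k^'j). c2 * norm (snd z *v fst z) \<le> (snd z *v fst z) \<bullet> e}"
  have "continuous_on UNIV (\<lambda>z :: (real^'k) \<times> (real^'k^'j). snd z *v fst z)"
    unfolding matrix_vector_mult_def by (intro continuous_intros)
  then have "closed ?Z" by (intro closed_Collect_le continuous_intros)
  then have "closed {A. \<exists>y. y \<in> sphere 0 1 \<and> (y, A) \<in> ?Z}"
    by (intro closed_compact_projection) auto
  with lower have "open ((\<Union>y. {A :: real^'k^'j. c1 * norm (A *v y) < (A *v y) \<bullet> e}) \<inter>
      - {A. \<exists>y. y \<in> sphere 0 1 \<and> (y, A) \<in> ?Z})"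
    by (intro open_Int open_Compl)
  also have "(\<Union>y. {A :: real^'k^'j. c1 * norm (A *v y) < (A *v y) \<bullet> e}) \<inter>
      - {A. \<exists>y. y \<in> sphere 0 1 \<and> (y, A) \<in> ?Z} = matrices_cos_between e c1 c2"
    by (force simp: matrices_cos_between_def not_le)
  finally show ?thesis .
qed

text \<open>For an isometry S into the hyperplane orthogonal to f, the vector c S b + sqrt (1 - c^2) f makes
  the angle arccos c with the range of S; T is S followed by a rotation that takes this vector to e.\<close>
lemma exists_isometry_inner:
  fixes e :: "real^'j" and b :: "real^'k"
  assumes card: "CARD('k::finite) < CARD('j)" and norm_e: "norm e = 1" and norm_b: "norm b = 1"
    and c_range: "0 \<le> c" "c \<le> 1"
  obtains T :: "real^'k \<Rightarrow> real^'j" where "linear T" "\<And>y. norm (T y) = norm y" "\<And>y. T y \<bullet> e = c * (y \<bullet> b)"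
proof -
  obtain f :: "real^'j" where "f \<in> Basis" using nonempty_Basis by blast
  then have f_unit: "f \<bullet> f = 1" "f \<noteq> 0" by auto
  have "dim (UNIV :: (real^'k) set) \<le> dim {x. f \<bullet> x = 0}"
    using card f_unit(2) by (simp add: dim_hyperplane)
  then obtain S :: "real^'k \<Rightarrow> real^'j" where S: "linear S" "range S \<subseteq> {x. f \<bullet> x = 0}" "\<And>y. norm (S y) = norm y"
    using isometry_subset_subspace[OF subspace_UNIV subspace_hyperplane]
    by (metis UNIV_I image_subset_iff_funcset)
  have S_inner: "S x \<bullet> S y = x \<bullet> y" for x y
    by (simp add: dot_norm S(3) flip: linear_add[OF S(1)])
  have "f \<bullet> S y = 0" for y using S(2) by blast
  then have f_orthogonal: "f \<bullet> S y = 0" "S y \<bullet> f = 0" for y by (simp_all add: inner_commute)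
  define e0 where "e0 = c *\<^sub>R S b + sqrt (1 - c\<^sup>2) *\<^sub>R f"
  have S_e0: "S y \<bullet> e0 = c * (y \<bullet> b)" for y
    by (simp add: e0_def inner_add_right S_inner f_orthogonal)
  have "b \<bullet> b = 1" "c\<^sup>2 \<le> 1" using norm_b c_range by (simp_all add: dot_square_norm power_le_one)
  then have "e0 \<bullet> e0 = 1"
    using f_unit by (simp add: e0_def inner_add_left inner_add_right S_inner f_orthogonal power2_eq_square)
  then have "norm e0 = norm e" using norm_e by (simp add: norm_eq_sqrt_inner)
  then obtain R where R: "orthogonal_transformation R" "R e0 = e"
    by (rule orthogonal_transformation_exists)
  show ?thesis
  proof
    show "linear (R \<circ> S)" by (rule linear_compose[OF S(1) orthogonal_transformation_linear[OF R(1)]])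
    show "norm ((R \<circ> S) y) = norm y" for y using R(1) by (simp add: S(3) orthogonal_transformation)
    show "(R \<circ> S) y \<bullet> e = c * (y \<bullet> b)" for y
      using R S_e0 unfolding orthogonal_transformation_def comp_def by metis
  qed
qed

lemma matrices_cos_between_nonempty:
  fixes e :: "real^'j"
  assumes card: "CARD('k::finite) < CARD('j)" and norm_e: "norm e = 1" and c_bounds: "0 \<le> c1" "c1 < c2" "c2 \<le> 1"
  shows "matrices_cos_between e c1 c2 \<noteq> ({} :: (real^'k^'j) set)"
proof -
  define c where "c = (c1 + c2) / 2"
  have c_between: "c1 < c" "c < c2" "0 \<le> c" "c \<le> 1" using c_bounds by (auto simp: c_def)
  obtain b :: "real^'k" where "b \<in> Basis" using nonempty_Basis by blast
  then have b_unit: "norm b = 1" "b \<bullet> b = 1" by auto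
  obtain T :: "real^'k \<Rightarrow> real^'j" where T: "linear T" "\<And>y. norm (T y) = norm y" "\<And>y. T y \<bullet> e = c * (y \<bullet> b)"
    using exists_isometry_inner[OF card norm_e b_unit(1) c_between(3,4)] by metis
  have matrix_T: "matrix T *v y = T y" for y by (simp add: matrix_works T(1))
  have "c1 * norm (matrix T *v b) < (matrix T *v b) \<bullet> e"
    using b_unit c_between by (simp add: matrix_T T)
  moreover have "(matrix T *v y) \<bullet> e < c2 * norm (matrix T *v y)" if "y \<in> sphere 0 1" for y
  proof -
    have "y \<bullet> b \<le> 1" using norm_cauchy_schwarz[of y b] that b_unit by simp
    then have "(matrix T *v y) \<bullet> e \<le> c * 1"
      unfolding matrix_T T(3) using c_between by (intro mult_left_mono) auto
    also have "\<dots> < c2 * norm (matrix T *v y)" using that c_between by (simp add: matrix_T T(2))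
    finally show ?thesis .
  qed
  ultimately show ?thesis by (auto simp: matrices_cos_between_def)
qed

lemma matrices_cos_betweenD:
  fixes A :: "real^'k^'j"
  assumes A: "A \<in> matrices_cos_between e c1 c2" and norm_e: "norm e = 1" and c_bounds: "0 \<le> c1" "c1 < c2"
  shows "inj (\<lambda>y. A *v y)" and "c1 < plane_cos e (range (\<lambda>y. A *v y))"
    and "plane_cos e (range (\<lambda>y. A *v y)) < c2"
proof -
  let ?V = "range (\<lambda>y. A *v y)"
  have inner_less: "(A *v y) \<bullet> e < c2 * norm (A *v y)" if "y \<noteq> 0" for y
  proof -
    have "(A *v (y /\<^sub>R norm y)) \<bullet> e < c2 * norm (A *v (y /\<^sub>R norm y))"
      using A that by (simp add: matrices_cos_between_def)
    then show ?thesis using that by (simp add: matrix_vector_mult_scaleR field_simps)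
  qed
  then have "y = 0" if "A *v y = 0" for y using that by fastforce
  then show inj: "inj (\<lambda>y. A *v y)"
    by (subst linear_injective_0) auto
  note V = subspace_range_matrix[of A] dim_range_matrix[OF inj]
  obtain y where "c1 * norm (A *v y) < (A *v y) \<bullet> e" using A by (auto simp: matrices_cos_between_def)
  then show "c1 < plane_cos e ?V" by (intro plane_cos_greater[OF V norm_e]) auto
  show "plane_cos e ?V < c2"
  proof (rule plane_cos_less[OF V norm_e])
    fix x assume "x \<in> ?V" "x \<noteq> 0"
    then obtain y where "x = A *v y" "y \<noteq> 0" by fastforce
    then show "x \<bullet> e < c2 * norm x" using inner_less by simp
  qed (use c_bounds in simp)
qed

lemma AE_planes_cos_between:
  fixes e :: "real^'j"
  assumes card: "CARD('k::finite) < CARD('j)" and norm_e: "norm e = 1" and c_bounds: "0 \<le> c1" "c1 < c2" "c2 \<le> 1"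
    and AE_P: "AE_planes TYPE('k) e P"
  obtains V where "subspace V" "dim V = CARD('k)" "P V" "c1 < plane_cos e V" "plane_cos e V < c2"
proof -
  let ?Q = "\<lambda>A :: real^'k^'j. inj (\<lambda>y. A *v y) \<and> sdist_set e (range (\<lambda>y. A *v y) \<inter> sphere 0 1) < pi / 2
       \<longrightarrow> P (range (\<lambda>y. A *v y))"
  let ?U = "matrices_cos_between e c1 c2 :: (real^'k^'j) set"
  have "\<exists>A \<in> ?U. ?Q A"
  proof (rule ccontr)
    assume none: "\<not> (\<exists>A \<in> ?U. ?Q A)"
    have "AE A in lborel. ?Q A" using AE_P by (simp add: AE_planes_def)
    then have "AE A in lborel. A \<notin> ?U"
      by (rule eventually_mono) (use none in blast)
    then have "?U \<in> null_sets lborel"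
      by (subst AE_iff_null_sets) (auto simp: open_matrices_cos_between)
    then have "negligible ?U"
      unfolding negligible_iff_null_sets by (rule null_sets_completionI)
    then show False
      using open_not_negligible[OF open_matrices_cos_between matrices_cos_between_nonempty[OF card norm_e c_bounds]]
      by blast
  qed
  then obtain A where A: "A \<in> ?U" and plane_imp: "?Q A" by blast
  note cos = matrices_cos_betweenD[OF A norm_e c_bounds(1,2)]
  note V = subspace_range_matrix[of A] dim_range_matrix[OF cos(1)]
  have "P (range (\<lambda>y. A *v y))"
    using plane_imp cos c_bounds sdist_set_less_pi_half_iff[OF V norm_e] by auto
  then show ?thesis by (rule that[OF V _ cos(2,3)])
qed

lemma radon_indicator:
  fixes V :: "(real^'j) set" and e :: "real^'j"
  assumes V: "subspace V" "dim V = CARD('k)" and norm_e: "norm e = 1" and card_k: "CARD('k::finite) \<ge> 2"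
    and [measurable]: "E \<in> sets borel" and integrable: "radon_integrable TYPE('k) (\<lambda>x. indicator E \<bar>x \<bullet> e\<bar>) V"
  shows "ennreal \<bar>radon TYPE('k) (\<lambda>x. indicator E \<bar>x \<bullet> e\<bar>) V\<bar> =
    ennreal (slice_const CARD('k)) * emeasure (slice_measure 0 (real CARD('k) - 1)) {t. plane_cos e V * t \<in> E}"
proof -
  let ?L = "slice_measure 0 (real CARD('k) - 1)"
  have "0 \<le> radon TYPE('k) (\<lambda>x. indicator E \<bar>x \<bullet> e\<bar>) V"
    unfolding radon_def by (intro integral_nonneg_AE) auto
  then have "ennreal \<bar>radon TYPE('k) (\<lambda>x. indicator E \<bar>x \<bullet> e\<bar>) V\<bar>
      = (\<integral>\<^sup>+y. ennreal (indicator E \<bar>param_iso V y \<bullet> e\<bar>) \<partial>(sphere_measure :: (real^'k) measure))"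
    unfolding radon_def using integrable
    by (subst nn_integral_eq_integral) (auto simp: radon_integrable_def)
  also have "\<dots> = ennreal (slice_const CARD('k)) * (\<integral>\<^sup>+t. ennreal (indicator E (plane_cos e V * t)) \<partial>?L)"
    by (rule nn_integral_param_iso[OF V norm_e card_k]) measurable
  also have "(\<integral>\<^sup>+t. ennreal (indicator E (plane_cos e V * t)) \<partial>?L)
      = (\<integral>\<^sup>+t. indicator {t. plane_cos e V * t \<in> E} t \<partial>?L)"
    by (intro nn_integral_cong) (simp add: indicator_def)
  also have "\<dots> = emeasure ?L {t. plane_cos e V * t \<in> E}"
    by (rule nn_integral_indicator) simp
  finally show ?thesis .
qed

lemma lorentz_norm_weighted_sphere_indicator:
  fixes e :: "real^'n"
  assumes norm_e: "norm e = 1" and dim_ge_2: "CARD('n) \<ge> 2" and p_pos: "0 < p" and E_borel: "E \<in> sets borel"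
  shows "lorentz_norm (weighted_sphere_measure e a1 a2) p (\<lambda>x. indicator E \<bar>x \<bullet> e\<bar>) =
    ennreal (slice_const CARD('n) powr (1 / p) * p) *
      enn_powr (emeasure (slice_measure a2 (a1 + real CARD('n) - 1)) E) (1 / p)"
proof -
  have "lorentz_norm (weighted_sphere_measure e a1 a2) p (\<lambda>x. indicator E \<bar>x \<bullet> e\<bar>) =
      ennreal (slice_const CARD('n) powr (1 / p)) *
        lorentz_norm (slice_measure a2 (a1 + real CARD('n) - 1)) p (indicator E)"
    using E_borel by (intro lorentz_norm_weighted_sphere[OF norm_e dim_ge_2 p_pos]) auto
  then show ?thesis
    using E_borel p_pos by (simp add: lorentz_norm_indicator ennreal_mult mult.assoc)
qed

lemma radon_estimate_imp_dilation_dense: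
  fixes e :: "real^'j"
  assumes norm_e: "norm e = 1" and card_k: "CARD('k::finite) \<ge> 2" and card: "CARD('k) < CARD('j)"
    and p_pos: "p > 0"
    and estimate: "radon_estimate TYPE('k) e a1 a2 p \<gamma>"
  defines "L \<equiv> slice_measure 0 (real CARD('k) - 1)" and "N \<equiv> slice_measure a2 (a1 + real CARD('j) - 1)"
  obtains C where "C \<ge> 0"
    and "\<And>E c1 c2. \<lbrakk>E \<in> sets borel; emeasure N E < \<infinity>; 0 \<le> c1; c1 < c2; c2 \<le> 1\<rbrakk> \<Longrightarrow>
      \<exists>c. c1 < c \<and> c < c2 \<and>
        ennreal (c powr \<gamma>) * emeasure L {t. c * t \<in> E} \<le> ennreal C * enn_powr (emeasure N E) (1 / p)"
proof -
  have card_j: "CARD('j) \<ge> 2" using card_k card by simp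
  define J0 K0 where "J0 = slice_const CARD('j) powr (1 / p) * p" and "K0 = slice_const CARD('k)"
  have J0_nonneg: "J0 \<ge> 0" and K0_pos: "K0 > 0"
    using slice_const_pos[OF card_k] p_pos by (simp_all add: J0_def K0_def)
  let ?norm = "lorentz_norm (weighted_sphere_measure e a1 a2) p"
  obtain C0 where C0_nonneg: "C0 \<ge> 0" and bound: "\<And>f. f \<in> borel_measurable sphere_measure \<Longrightarrow> even_radial e f \<Longrightarrow>
      ?norm f < \<infinity> \<Longrightarrow> AE_planes TYPE('k) e (\<lambda>V. radon_integrable TYPE('k) f V \<and>
       ennreal \<bar>plane_cos e V powr \<gamma> * radon TYPE('k) f V\<bar> \<le> ennreal C0 * ?norm f)"
    using estimate unfolding radon_estimate_def by blast
  show ?thesis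
  proof
    show "C0 * J0 / K0 \<ge> 0" using C0_nonneg J0_nonneg K0_pos by simp
    fix E :: "real set" and c1 c2 :: real
    assume [measurable]: "E \<in> sets borel" and "emeasure N E < \<infinity>" and c_bounds: "0 \<le> c1" "c1 < c2" "c2 \<le> 1"
    let ?f = "\<lambda>x. indicator E \<bar>x \<bullet> e\<bar> :: real"
    have norm_f: "?norm ?f = ennreal J0 * enn_powr (emeasure N E) (1 / p)"
      unfolding J0_def N_def by (rule lorentz_norm_weighted_sphere_indicator[OF norm_e card_j p_pos]) measurable
    moreover have "enn_powr (emeasure N E) (1 / p) < \<infinity>"
      using \<open>emeasure N E < \<infinity>\<close> by (cases "emeasure N E") (auto simp: enn_powr_ennreal)
    ultimately have "?norm ?f < \<infinity>" by (simp add: ennreal_mult_less_top)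
    moreover have "?f \<in> borel_measurable sphere_measure" by measurable
    moreover have "even_radial e ?f" unfolding even_radial_def by blast
    ultimately obtain V where V: "subspace V" "dim V = CARD('k)" and integrable: "radon_integrable TYPE('k) ?f V"
      and radon_le: "ennreal \<bar>plane_cos e V powr \<gamma> * radon TYPE('k) ?f V\<bar> \<le> ennreal C0 * ?norm ?f"
      and cos: "c1 < plane_cos e V" "plane_cos e V < c2"
      using AE_planes_cos_between[OF card norm_e c_bounds bound] by metis
    let ?A = "ennreal (plane_cos e V powr \<gamma>) * emeasure L {t. plane_cos e V * t \<in> E}"
    let ?B = "ennreal (C0 * J0 / K0) * enn_powr (emeasure N E) (1 / p)"
    have "ennreal K0 * ?A = ennreal \<bar>plane_cos e V powr \<gamma> * radon TYPE('k) ?f V\<bar>"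
      using radon_indicator[OF V norm_e card_k _ integrable]
      by (simp add: abs_mult ennreal_mult K0_def L_def mult.left_commute)
    also note radon_le
    also have "ennreal C0 * ?norm ?f = ennreal K0 * ?B"
      using C0_nonneg J0_nonneg K0_pos by (simp add: norm_f mult.assoc[symmetric] ennreal_mult[symmetric])
    finally have "?A \<le> ?B" using K0_pos by (subst (asm) ennreal_mult_le_mult_iff) auto
    with cos show "\<exists>c. c1 < c \<and> c < c2 \<and> ennreal (c powr \<gamma>) * emeasure L {t. c * t \<in> E} \<le> ?B"
      by blast
  qed
qed

lemma indicator_dilation_le_liminf:
  fixes E :: "real set"
  assumes "open E" and r_lim: "r \<longlonglongrightarrow> c" and "0 < c"
  shows "ennreal (c powr \<gamma>) * indicator {t. c * t \<in> E} t
    \<le> liminf (\<lambda>n. ennreal (r n powr \<gamma>) * indicator {t. r n * t \<in> E} t)"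
proof (cases "c * t \<in> E")
  case True
  have "(\<lambda>n. r n * t) \<longlonglongrightarrow> c * t" by (intro tendsto_intros r_lim)
  then have "eventually (\<lambda>n. r n * t \<in> E) sequentially" using topological_tendstoD \<open>open E\<close> True by blast
  then have "eventually (\<lambda>n. ennreal (r n powr \<gamma>)
      = ennreal (r n powr \<gamma>) * indicator {t. r n * t \<in> E} t) sequentially"
    by (rule eventually_mono) simp
  moreover have "(\<lambda>n. ennreal (r n powr \<gamma>)) \<longlonglongrightarrow> ennreal (c powr \<gamma>)"
    using \<open>0 < c\<close> by (intro tendsto_intros tendsto_ennrealI r_lim) auto
  ultimately have "(\<lambda>n. ennreal (r n powr \<gamma>) * indicator {t. r n * t \<in> E} t) \<longlonglongrightarrow> ennreal (c powr \<gamma>)"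
    by (rule Lim_transform_eventually[rotated])
  then show ?thesis using True by (simp add: lim_imp_Liminf)
qed simp

text \<open>By Fatou's lemma the left-hand side is lower semicontinuous in c when E is open.\<close>
lemma emeasure_dilation_le_of_dense:
  fixes E :: "real set" and M :: "real measure"
  assumes [measurable_cong]: "sets M = sets borel" and "open E" and c: "0 < c" "c < 1"
    and dense: "\<And>c1 c2. \<lbrakk>0 \<le> c1; c1 < c2; c2 \<le> 1\<rbrakk> \<Longrightarrow>
      \<exists>c. c1 < c \<and> c < c2 \<and> ennreal (c powr \<gamma>) * emeasure M {t. c * t \<in> E} \<le> B"
  shows "ennreal (c powr \<gamma>) * emeasure M {t. c * t \<in> E} \<le> B"
proof -
  have [measurable]: "E \<in> sets borel" using \<open>open E\<close> by simp
  have "\<exists>r. c * (1 - inverse (real (Suc n))) < r \<and> r < c \<and> ennreal (r powr \<gamma>) * emeasure M {t. r * t \<in> E} \<le> B"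
    for n
    using c by (intro dense) (auto simp: field_simps)
  then obtain r where r_between: "\<And>n. c * (1 - inverse (real (Suc n))) < r n" "\<And>n. r n < c"
    and bound: "\<And>n. ennreal (r n powr \<gamma>) * emeasure M {t. r n * t \<in> E} \<le> B"
    by metis
  have r_lim: "r \<longlonglongrightarrow> c"
  proof (rule real_tendsto_sandwich)
    have "(\<lambda>n. c * (1 - inverse (real (Suc n)))) \<longlonglongrightarrow> c * (1 - 0)"
      by (intro tendsto_intros LIMSEQ_inverse_real_of_nat)
    then show "(\<lambda>n. c * (1 - inverse (real (Suc n)))) \<longlonglongrightarrow> c" by simp
    show "(\<lambda>n. c) \<longlonglongrightarrow> c" by (rule tendsto_const)
    show "\<forall>\<^sub>F n in sequentially. c * (1 - inverse (real (Suc n))) \<le> r n" "\<forall>\<^sub>F n in sequentially. r n \<le> c"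
      by (intro always_eventually allI less_imp_le r_between)+
  qed
  have "ennreal (c powr \<gamma>) * emeasure M {t. c * t \<in> E}
      = (\<integral>\<^sup>+t. ennreal (c powr \<gamma>) * indicator {t. c * t \<in> E} t \<partial>M)"
    by (simp add: nn_integral_cmult_indicator)
  also have "\<dots> \<le> (\<integral>\<^sup>+t. liminf (\<lambda>n. ennreal (r n powr \<gamma>) * indicator {t. r n * t \<in> E} t) \<partial>M)"
    by (intro nn_integral_mono indicator_dilation_le_liminf \<open>open E\<close> r_lim c)
  also have "\<dots> \<le> liminf (\<lambda>n. \<integral>\<^sup>+t. ennreal (r n powr \<gamma>) * indicator {t. r n * t \<in> E} t \<partial>M)"
    by (rule nn_integral_liminf) measurable
  also have "\<dots> \<le> B"
    using bound by (intro Liminf_le) (simp_all add: nn_integral_cmult_indicator)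
  finally show ?thesis .
qed

lemma radon_estimate_imp_dilation:
  fixes e :: "real^'j"
  assumes norm_e: "norm e = 1" and card_k: "CARD('k::finite) \<ge> 2" and card: "CARD('k) < CARD('j)"
    and p_pos: "p > 0"
    and estimate: "radon_estimate TYPE('k) e a1 a2 p \<gamma>"
  obtains C where "C \<ge> 0"
    and "\<And>E c. \<lbrakk>open E; emeasure (slice_measure a2 (a1 + real CARD('j) - 1)) E < \<infinity>; 0 < c; c < 1\<rbrakk> \<Longrightarrow>
      ennreal (c powr \<gamma>) * emeasure (slice_measure 0 (real CARD('k) - 1)) {t. c * t \<in> E}
        \<le> ennreal C * enn_powr (emeasure (slice_measure a2 (a1 + real CARD('j) - 1)) E) (1 / p)"
proof -
  obtain C where C_nonneg: "C \<ge> 0" and dense: "\<And>E c1 c2. \<lbrakk>E \<in> sets borel;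
      emeasure (slice_measure a2 (a1 + real CARD('j) - 1)) E < \<infinity>; 0 \<le> c1; c1 < c2; c2 \<le> 1\<rbrakk> \<Longrightarrow>
      \<exists>c. c1 < c \<and> c < c2 \<and> ennreal (c powr \<gamma>) * emeasure (slice_measure 0 (real CARD('k) - 1)) {t. c * t \<in> E}
        \<le> ennreal C * enn_powr (emeasure (slice_measure a2 (a1 + real CARD('j) - 1)) E) (1 / p)"
    using radon_estimate_imp_dilation_dense[OF norm_e card_k card p_pos estimate] by metis
  show ?thesis
    by (rule that[OF C_nonneg emeasure_dilation_le_of_dense]) (auto intro!: dense)
qed

lemma powr_le_near:
  fixes a t \<delta> :: real
  assumes "0 < \<delta>" "\<delta> / 2 \<le> t" "t \<le> \<delta>"
  shows "t powr a \<le> 2 powr \<bar>a\<bar> * \<delta> powr a"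
proof (cases "a \<ge> 0")
  case True
  then have "t powr a \<le> 1 * \<delta> powr a" using assms by (simp add: powr_mono2)
  also have "\<dots> \<le> 2 powr \<bar>a\<bar> * \<delta> powr a" by (intro mult_right_mono ge_one_powr_ge_zero) auto
  finally show ?thesis .
next
  case False
  then have "t powr a \<le> (\<delta> / 2) powr a" using assms by (intro powr_mono2') auto
  also have "\<dots> = 2 powr \<bar>a\<bar> * \<delta> powr a"
    using False assms by (simp add: powr_divide powr_minus_divide)
  finally show ?thesis .
qed

lemma emeasure_slice_band_le:
  assumes \<delta>: "0 < \<delta>" "\<delta> \<le> 1/2" and \<eta>: "0 < \<eta>" "\<eta> \<le> 1/2" and "b \<ge> 0"
  shows "emeasure (slice_measure a b) {\<delta> * (1 - \<eta>)<..<\<delta>}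
    \<le> ennreal (2 powr \<bar>a\<bar> * (4/3) * (\<delta> powr (1 + a) * \<eta>))"
proof -
  have endpoints: "\<delta> * (1 - \<eta>) \<le> \<delta>" using \<delta> \<eta> by (simp add: mult_left_le)
  have "emeasure (slice_measure a b) {\<delta> * (1 - \<eta>)<..<\<delta>}
      \<le> ennreal ((2 powr \<bar>a\<bar> * \<delta> powr a) * (4/3)) * emeasure lborel {\<delta> * (1 - \<eta>)<..<\<delta>}"
  proof (rule emeasure_slice_measure_le)
    fix t assume t: "t \<in> {\<delta> * (1 - \<eta>)<..<\<delta>}" "0 < t" "t < 1"
    have "\<delta> * (1/2) \<le> \<delta> * (1 - \<eta>)" using \<delta> \<eta> by (intro mult_left_mono) auto
    also have "\<dots> < t" using t by simp
    finally have "t powr a \<le> 2 powr \<bar>a\<bar> * \<delta> powr a"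
      using t \<delta> by (intro powr_le_near) auto
    moreover have "(1 - t\<^sup>2) powr (b / 2 - 1) \<le> 4/3"
      using t \<delta> \<open>b \<ge> 0\<close> by (intro one_minus_square_powr_le) auto
    ultimately show "t powr a * (1 - t\<^sup>2) powr (b / 2 - 1) \<le> (2 powr \<bar>a\<bar> * \<delta> powr a) * (4/3)"
      by (intro mult_mono) auto
  qed simp
  also have "emeasure lborel {\<delta> * (1 - \<eta>)<..<\<delta>} = ennreal (\<delta> * \<eta>)"
    using endpoints by (simp add: algebra_simps)
  finally show ?thesis
    using \<delta> \<eta> by (simp add: ennreal_mult[symmetric] powr_add mult_ac)
qed

lemma emeasure_slice_end_ge_powr:
  assumes \<eta>: "0 < \<eta>" "\<eta> \<le> 1" and k_pos: "k > 0"
  shows "ennreal (\<eta> powr (k / 2) / k) \<le> emeasure (slice_measure 0 k) {1 - \<eta><..<1}"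
proof -
  have "\<eta> \<le> 1 - (1 - \<eta>)\<^sup>2"
    using \<eta> mult_left_le[of \<eta> \<eta>] by (simp add: power2_eq_square algebra_simps)
  then have "\<eta> powr (k / 2) \<le> (1 - (1 - \<eta>)\<^sup>2) powr (k / 2)"
    using \<eta> k_pos by (intro powr_mono2) auto
  then have "ennreal (\<eta> powr (k / 2) / k) \<le> ennreal ((1 - (1 - \<eta>)\<^sup>2) powr (k / 2) / k)"
    using k_pos by (intro ennreal_leI divide_right_mono) auto
  also have "\<dots> \<le> emeasure (slice_measure 0 k) {1 - \<eta><..<1}"
    using \<eta> k_pos by (intro emeasure_slice_measure_end_ge) auto
  finally show ?thesis .
qed

text \<open>The dilation c = \<delta> carries the band (\<delta> (1 - \<eta>), \<delta>) to the end (1 - \<eta>, 1) of the unit interval.\<close>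
lemma radon_estimate_imp_band_bound:
  fixes e :: "real^'j"
  assumes norm_e: "norm e = 1" and card_k: "CARD('k::finite) \<ge> 2" and card: "CARD('k) < CARD('j)"
    and p_pos: "p > 0"
    and exponent: "a1 + real CARD('j) - 1 = p * (real CARD('k) - 1)"
    and estimate: "radon_estimate TYPE('k) e a1 a2 p \<gamma>"
  defines "k \<equiv> real CARD('k) - 1"
  obtains D where "\<And>\<delta> \<eta>. \<lbrakk>0 < \<delta>; \<delta> \<le> 1/2; 0 < \<eta>; \<eta> \<le> 1/2\<rbrakk> \<Longrightarrow>
    \<delta> powr \<gamma> * \<eta> powr (k / 2) \<le> D * (\<delta> powr ((1 + a2) / p) * \<eta> powr (1 / p))"
proof -
  have k_pos: "k > 0" using card_k by (simp add: k_def)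
  let ?N = "slice_measure a2 (p * k)"
  obtain C where C_nonneg: "C \<ge> 0"
    and dilation: "\<And>E c. \<lbrakk>open E; emeasure ?N E < \<infinity>; 0 < c; c < 1\<rbrakk> \<Longrightarrow>
      ennreal (c powr \<gamma>) * emeasure (slice_measure 0 k) {t. c * t \<in> E}
        \<le> ennreal C * enn_powr (emeasure ?N E) (1 / p)"
    using radon_estimate_imp_dilation[OF norm_e card_k card p_pos estimate] unfolding exponent k_def by metis
  define H where "H = 2 powr \<bar>a2\<bar> * (4/3)"
  have H_pos: "H > 0" by (simp add: H_def)
  have "\<delta> powr \<gamma> * \<eta> powr (k / 2) \<le> (k * C * H powr (1 / p)) * (\<delta> powr ((1 + a2) / p) * \<eta> powr (1 / p))"
    if \<delta>: "0 < \<delta>" "\<delta> \<le> 1/2" and \<eta>: "0 < \<eta>" "\<eta> \<le> 1/2" for \<delta> \<eta>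
  proof -
    let ?E = "{\<delta> * (1 - \<eta>)<..<\<delta>}"
    have N_le: "emeasure ?N ?E \<le> ennreal (H * (\<delta> powr (1 + a2) * \<eta>))"
      unfolding H_def using p_pos k_pos by (intro emeasure_slice_band_le \<delta> \<eta>) auto
    then have N_finite: "emeasure ?N ?E < \<infinity>" by (simp add: le_less_trans)
    have band_dilated: "{t. \<delta> * t \<in> ?E} = {1 - \<eta><..<1}" using \<delta> by auto
    have "ennreal (\<delta> powr \<gamma> * (\<eta> powr (k / 2) / k))
        \<le> ennreal (\<delta> powr \<gamma>) * emeasure (slice_measure 0 k) {1 - \<eta><..<1}"
      using \<eta> k_pos by (subst ennreal_mult) (auto intro!: mult_left_mono emeasure_slice_end_ge_powr)
    also have "\<dots> \<le> ennreal C * enn_powr (emeasure ?N ?E) (1 / p)"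
      using dilation[OF open_greaterThanLessThan N_finite, of \<delta>, unfolded band_dilated] \<delta> by simp
    also have "\<dots> \<le> ennreal C * enn_powr (ennreal (H * (\<delta> powr (1 + a2) * \<eta>))) (1 / p)"
      using N_le p_pos by (intro mult_left_mono enn_powr_mono) auto
    also have "\<dots> = ennreal (C * (H powr (1 / p) * (\<delta> powr ((1 + a2) / p) * \<eta> powr (1 / p))))"
      using H_pos \<eta> C_nonneg by (simp add: enn_powr_ennreal powr_mult powr_powr ennreal_mult[symmetric])
    finally have "\<delta> powr \<gamma> * (\<eta> powr (k / 2) / k)
        \<le> C * (H powr (1 / p) * (\<delta> powr ((1 + a2) / p) * \<eta> powr (1 / p)))"
      using C_nonneg by simp
    then show ?thesis using k_pos by (simp add: field_simps)
  qed
  then show ?thesis by (rule that)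
qed

lemma powr_bound_near_0_imp_exponent_le:
  fixes s t A D d :: real
  assumes A_pos: "A > 0" and d_pos: "d > 0" and bound: "\<And>x. \<lbrakk>0 < x; x \<le> d\<rbrakk> \<Longrightarrow> A * x powr s \<le> D * x powr t"
  shows "t \<le> s"
proof (rule ccontr)
  assume "\<not> t \<le> s"
  then have "((\<lambda>x. D * x powr (t - s)) \<longlongrightarrow> D * 0 powr (t - s)) (at_right 0)"
    by (intro tendsto_intros tendsto_powr') (auto simp: eventually_at_filter)
  moreover have "eventually (\<lambda>x. A \<le> D * x powr (t - s)) (at_right 0)"
    using eventually_at_right_real[OF d_pos]
  proof (rule eventually_mono)
    fix x assume x: "x \<in> {0<..<d}"
    then have "A * x powr s \<le> D * x powr (t - s) * x powr s"
      using bound[of x] by (simp add: mult.assoc flip: powr_add)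
    then show "A \<le> D * x powr (t - s)" using x by simp
  qed
  ultimately have "A \<le> D * 0 powr (t - s)" by (rule tendsto_lowerbound) simp
  then show False using A_pos by simp
qed

lemma radon_estimate_necessary:
  fixes e :: "real^'j"
  assumes norm_e: "norm e = 1" and card_k: "CARD('k::finite) \<ge> 2" and card: "CARD('k) < CARD('j)"
    and p_pos: "p > 0"
    and exponent: "a1 + real CARD('j) - 1 = p * (real CARD('k) - 1)"
    and estimate: "radon_estimate TYPE('k) e a1 a2 p \<gamma>"
  shows "\<gamma> \<ge> (1 + a2) / p" and "p * (real CARD('k) - 1) \<ge> 2"
proof -
  define k where "k = real CARD('k) - 1"
  obtain D where band_bound: "\<And>\<delta> \<eta>. \<lbrakk>0 < \<delta>; \<delta> \<le> 1/2; 0 < \<eta>; \<eta> \<le> 1/2\<rbrakk> \<Longrightarrow>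
      \<delta> powr \<gamma> * \<eta> powr (k / 2) \<le> D * (\<delta> powr ((1 + a2) / p) * \<eta> powr (1 / p))"
    using radon_estimate_imp_band_bound[OF norm_e card_k card p_pos exponent estimate] unfolding k_def by metis
  show "\<gamma> \<ge> (1 + a2) / p"
  proof (rule powr_bound_near_0_imp_exponent_le)
    show "(1/2) powr (k / 2) > (0::real)" "1/2 > (0::real)" by simp_all
    show "(1/2) powr (k / 2) * \<delta> powr \<gamma> \<le> (D * (1/2) powr (1 / p)) * \<delta> powr ((1 + a2) / p)"
      if "0 < \<delta>" "\<delta> \<le> 1/2" for \<delta>
      using band_bound[OF that, of "1/2"] by (simp add: mult_ac)
  qed
  have "1 / p \<le> k / 2"
  proof (rule powr_bound_near_0_imp_exponent_le)
    show "(1/2) powr \<gamma> > (0::real)" "1/2 > (0::real)" by simp_all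
    show "(1/2) powr \<gamma> * \<eta> powr (k / 2) \<le> (D * (1/2) powr ((1 + a2) / p)) * \<eta> powr (1 / p)"
      if "0 < \<eta>" "\<eta> \<le> 1/2" for \<eta>
      using band_bound[of "1/2" \<eta>] that by (simp add: mult_ac)
  qed
  then show "p * (real CARD('k) - 1) \<ge> 2" using p_pos by (simp add: k_def field_simps)
qed

theorem theorem5p9:
  fixes n k :: nat and a1 a2 p \<gamma> :: real and i0 :: "'j::finite"
  assumes "CARD('j) = n + 1" and "CARD('k::finite) = k + 1"
    and "n \<ge> 2" and "1 \<le> k" and "k \<le> n - 1"
    and "a1 \<ge> real k - real n"
    and "p = (a1 + real n) / real k"
    and "p \<ge> 1 + a2" and "a2 > 0 \<longrightarrow> p > 1 + a2"
  shows "(k \<ge> 2 \<longrightarrow>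
            (radon_estimate TYPE('k) (axis i0 1 :: real^'j) a1 a2 p \<gamma>
               \<longleftrightarrow> \<gamma> \<ge> (1 + a2) / p))
       \<and> (k = 1 \<longrightarrow>
            (radon_estimate TYPE('k) (axis i0 1 :: real^'j) a1 a2 p \<gamma>
               \<longleftrightarrow> \<gamma> \<ge> (1 + a2) / p \<and> p \<ge> 2))"
proof -
  let ?estimate = "radon_estimate TYPE('k) (axis i0 1 :: real^'j) a1 a2 p \<gamma>"
  have card_j: "CARD('j) \<ge> 2" and card_k: "CARD('k) \<ge> 2" and card: "CARD('k) < CARD('j)"
    using assms(1-5) by auto
  have norm_axis: "norm (axis i0 1 :: real^'j) = 1" by simp
  have dim_k: "real CARD('k) - 1 = real k" using assms(2) by simp
  have exponent: "a1 + real CARD('j) - 1 = p * (real CARD('k) - 1)" using assms(1,2,4,7) by simp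
  have p_ge_1: "p \<ge> 1" using assms(4,6) unfolding assms(7) by (simp add: le_divide_eq)
  have sufficient: ?estimate if "\<gamma> \<ge> (1 + a2) / p" "p * real k \<ge> 2"
    using radon_estimate_sufficient[OF norm_axis card_j card_k exponent p_ge_1 assms(8) _ that(1)] that(2)
    unfolding dim_k by blast
  have "\<gamma> \<ge> (1 + a2) / p" "p * real k \<ge> 2" if ?estimate
    using radon_estimate_necessary[OF norm_axis card_k card _ exponent that] p_ge_1 unfolding dim_k by simp_all
  moreover have "p * real k \<ge> 2" if "k \<ge> 2"
    using mult_mono[of 1 p 2 "real k"] p_ge_1 that by simp
  ultimately show ?thesis using sufficient by auto
qed

end
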